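(* Let $n\ge5$ and $\alpha^*:=(n^2-5n+4)/(n^2-3n-2)$. Then there exists a constant $\delta>1/4$ such that for every $C\in\mathbb{S}_C$ and $u^*\in\mathbb{S}_u$ satisfying $$\mathbb{D}_{\alpha^*}(C,u^* )\le\delta n/\alpha^*,$$ the instance $\mathcal{MC}(C,u^* )$ does not have any spurious second-order critical points.
   Context: $\mathbb{S}_C$: the set of symmetric matrices $C\in\mathbb{R}^{n\times n}$ with nonnegative entries and $\sum_{i,j}C_{ij}=1$. $\mathbb{S}_u$: the set of $u\in\mathbb{R}^n$ with $\|u\|_1=1$. For $C\in\mathbb{S}_C$, $u^*\in\mathbb{S}_u$, the instance $\mathcal{MC}(C,u^* )$ is the problem of minimizing $g(u;C,u^* )=\sum_{i,j\in[n]}C_{ij}(u_iu_j-u_i^*u_j^* )^2$ over $u\in\mathbb{R}^n$. A spurious second-order critical point is a point $u$ with $\nabla g(u;C,u^* )=0$, $\nabla^2g(u;C,u^* )\succeq0$ and $uu^T\ne u^*(u^* )^T$. Degenerate set: $\mathcal{D}:=\{(C,u^* ): C\in\mathbb{S}_C, u^*\in\mathbb{S}_u, \exists u\in\mathbb{R}^n \text{ with } g(u;C,u^* )=0,\ uu^T\ne u^*(u^* )^T\}$. Complexity metric: $\mathbb{D}_\alpha(C,u^* ):=\left[\inf_{(\tilde C,\tilde u^* )\in\mathcal{D}}\alpha\|C-\tilde C\|_1+(1-\alpha)\|u^*-\tilde u^*\|_1\right]^{-1}$ for $\alpha\in[0,1]$, with entrywise $\ell_1$-norms and the convention $1/0=+\infty$.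 *)

theory Defs
  imports "HOL-Analysis.Analysis"
begin

definition l1_norm_vec :: "real^'n \<Rightarrow> real"
  where "l1_norm_vec u = (\<Sum>i\<in>UNIV. \<bar>u $ i\<bar>)"

definition l1_norm_mat :: "real^'n^'m \<Rightarrow> real"
  where "l1_norm_mat A = (\<Sum>i\<in>UNIV. \<Sum>j\<in>UNIV. \<bar>A $ i $ j\<bar>)"

definition outer :: "real^'n \<Rightarrow> real^'n^'n"
  where "outer u = (\<chi> i j. u $ i * u $ j)"

definition S_C :: "(real^'n^'n) set"
  where "S_C = {C. transpose C = C \<and> (\<forall>i j. 0 \<le> C $ i $ j) \<and>
                  (\<Sum>i\<in>UNIV. \<Sum>j\<in>UNIV. C $ i $ j) = 1}"

definition S_u :: "(real^'n) set"
  where "S_u = {u. l1_norm_vec u = 1}"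

definition mc_objective :: "real^'n^'n \<Rightarrow> real^'n \<Rightarrow> real^'n \<Rightarrow> real"
  where "mc_objective C us u =
    (\<Sum>i\<in>UNIV. \<Sum>j\<in>UNIV. C $ i $ j * (u $ i * u $ j - us $ i * us $ j)\<^sup>2)"

text \<open>The Hessian is the matrix of the Frechet derivative of the gradient field. As derivatives are
  unique, \<^term>\<open>H\<close> is determined by \<^term>\<open>f\<close> and \<^term>\<open>x\<close>.\<close>

definition has_hessian :: "(real^'n \<Rightarrow> real) \<Rightarrow> real^'n^'n \<Rightarrow> real^'n \<Rightarrow> bool"
  where "has_hessian f H x \<longleftrightarrow>
    (\<exists>G. (\<forall>\<^sub>F y in nhds x. GDERIV f y :> G y) \<and> (G has_derivative (\<lambda>h. H *v h)) (at x))"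

definition psd :: "real^'n^'n \<Rightarrow> bool"
  where "psd H \<longleftrightarrow> transpose H = H \<and> (\<forall>h. 0 \<le> h \<bullet> (H *v h))"

definition second_order_critical :: "(real^'n \<Rightarrow> real) \<Rightarrow> real^'n \<Rightarrow> bool"
  where "second_order_critical f x \<longleftrightarrow> GDERIV f x :> 0 \<and> (\<exists>H. has_hessian f H x \<and> psd H)"

definition spurious_socp :: "real^'n^'n \<Rightarrow> real^'n \<Rightarrow> real^'n \<Rightarrow> bool"
  where "spurious_socp C us u \<longleftrightarrow>
    second_order_critical (mc_objective C us) u \<and> outer u \<noteq> outer us"

definition degenerate_set :: "((real^'n^'n) \<times> (real^'n)) set"
  where "degenerate_set = {(C, us). C \<in> S_C \<and> us \<in> S_u \<and>
    (\<exists>u. mc_objective C us u = 0 \<and> outer u \<noteq> outer us)}"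

text \<open>Extended reals give exactly the convention \<open>1/0 = +\<infinity>\<close>
  (for \<^typ>\<open>real\<close>, the inverse of 0 would be 0).\<close>

definition complexity_metric :: "real \<Rightarrow> real^'n^'n \<Rightarrow> real^'n \<Rightarrow> ereal"
  where "complexity_metric \<alpha> C us =
    inverse (INF (C', us') \<in> degenerate_set.
      ereal (\<alpha> * l1_norm_mat (C - C') + (1 - \<alpha>) * l1_norm_vec (us - us')))"

end

theory Submission
  imports Defs
begin

text \<open>
  The distance from any instance to the degenerate set is at most \<open>4\<alpha>/n\<close>. Isolating node \<open>i\<close> by moving
  its off-diagonal row weight to \<open>C\<^sub>i\<^sub>i\<close> costs \<open>4\<alpha>\<close> times that row weight, so equality forces a zero
  diagonal and equal row sums. Truncating \<open>u\<^sup>*\<close> to four indices and deleting a perfect matching on them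
  leaves a bipartite, hence degenerate, instance; \<open>\<alpha>\<^sup>*\<close> is the value at which the cost of this, averaged
  over the choices, is again \<open>4\<alpha>/n\<close>. Equality in all these bounds then forces the off-diagonal entries
  of \<open>C\<close> and the moduli of \<open>u\<^sup>*\<close> to be constant. For such an instance the only critical points are
  \<open>\<plusminus>u\<^sup>*\<close> and \<open>0\<close>, the latter with negative curvature along \<open>u\<^sup>*\<close>. A sequence of instances with
  distances tending to \<open>4\<alpha>/n\<close> and with spurious points accumulates at such an instance; its spurious
  points can neither escape to infinity nor accumulate at \<open>\<plusminus>u\<^sup>*\<close>.
\<close>

section \<open>Double sums and an extremal problem on pairs\<close>

lemma sum_remove_UNIV:
  fixes f :: "'a::finite \<Rightarrow> 'b::ab_group_add"
  shows "sum f (UNIV - {i}) = sum f UNIV - f i"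
  by (simp add: sum_diff1)

lemma double_sum_split_cross:
  fixes f :: "'a::finite \<Rightarrow> 'a \<Rightarrow> real"
  shows "(\<Sum>a\<in>UNIV. \<Sum>b\<in>UNIV. f a b) =
    f i i + (\<Sum>b\<in>UNIV - {i}. f i b) + (\<Sum>a\<in>UNIV - {i}. f a i)
      + (\<Sum>a\<in>UNIV - {i}. \<Sum>b\<in>UNIV - {i}. f a b)"
  by (simp add: sum_remove_UNIV sum_subtractf algebra_simps)

lemma member_le_double_sum:
  fixes f :: "'a \<Rightarrow> 'a \<Rightarrow> real"
  assumes "finite A" "i \<in> A" "j \<in> A" and nonneg: "\<And>a b. 0 \<le> f a b"
  shows "f i j \<le> (\<Sum>a\<in>A. \<Sum>b\<in>A. f a b)"
proof -
  have "f i j \<le> (\<Sum>b\<in>A. f i b)"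
    using assms by (intro member_le_sum) auto
  also have "\<dots> \<le> (\<Sum>a\<in>A. \<Sum>b\<in>A. f a b)"
    using assms by (intro member_le_sum[of i A "\<lambda>a. \<Sum>b\<in>A. f a b"] sum_nonneg) auto
  finally show ?thesis .
qed

text \<open>Summing the inequality over all pairs disjoint from a fixed pair is summing over its
  neighbours in the Kneser graph of 2-subsets. The bound on the total leaves no slack, so all these
  sums are tight, and the resulting linear system has only the constant solution.\<close>

lemma kneser_extremal:
  fixes D :: "'n::finite \<Rightarrow> 'n \<Rightarrow> real" and \<theta> :: real
  assumes n5: "CARD('n) \<ge> 5"
    and sym: "\<And>k l. D k l = D l k"
    and diag: "\<And>k. D k k = 0"
    and disj: "\<And>k l m p. distinct [k, l, m, p] \<Longrightarrow> 2 * \<theta> \<le> D k l + D m p"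
    and tot: "(\<Sum>k\<in>UNIV. \<Sum>l\<in>UNIV. D k l) \<le> real CARD('n) * (real CARD('n) - 1) * \<theta>"
    and kl: "k \<noteq> l"
  shows "D k l = \<theta>"
proof -
  define n where "n = real CARD('n)"
  have n: "n \<ge> 5" using n5 unfolding n_def by simp
  define R where "R k = (\<Sum>l\<in>UNIV. D k l)" for k
  define T where "T = (\<Sum>k\<in>UNIV. R k)"
  define N where "N = (n - 2) * (n - 3)"
  \<comment> \<open>For \<open>k \<noteq> l\<close>, \<open>E k l\<close> is the sum of the slacks
    \<open>D k l + D m p - 2 * \<theta>\<close> over the \<open>N\<close> ordered pairs of distinct
    \<open>m\<close>, \<open>p\<close> outside \<open>{k, l}\<close>, rewritten through row
    sums.\<close>
  define E where "E k l = (N + 2) * D k l + T - 2 * R k - 2 * R l - N * (2 * \<theta>)" for k l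
  have Rcol: "(\<Sum>m\<in>UNIV. D m k) = R k" for k
    unfolding R_def using sym by (intro sum.cong) auto
  have E_nonneg: "0 \<le> E k l" if "k \<noteq> l" for k l
  proof -
    have c3: "real (card (UNIV - {k, l, m})) = n - 3" if "m \<in> UNIV - {k, l}" for m
      using that \<open>k \<noteq> l\<close> n5 by (auto simp: card_Diff_subset n_def of_nat_diff)
    have c2: "real (card (UNIV - {k, l})) = n - 2"
      using \<open>k \<noteq> l\<close> n5 by (auto simp: card_Diff_subset n_def of_nat_diff)
    have inner: "(\<Sum>p\<in>UNIV - {k, l, m}. D m p) = R m - D m k - D m l" if "m \<in> UNIV - {k, l}" for m
    proof -
      have "(\<Sum>p\<in>UNIV - {k, l, m}. D m p) = R m - (\<Sum>p\<in>{k, l, m}. D m p)"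
        unfolding R_def by (rule sum_diff) auto
      then show ?thesis using that \<open>k \<noteq> l\<close> diag by auto
    qed
    have "N * (2 * \<theta>) = (\<Sum>m\<in>UNIV - {k, l}. \<Sum>p\<in>UNIV - {k, l, m}. 2 * \<theta>)"
      using c3 c2 by (simp add: N_def)
    also have "\<dots> \<le> (\<Sum>m\<in>UNIV - {k, l}. \<Sum>p\<in>UNIV - {k, l, m}. D k l + D m p)"
      using \<open>k \<noteq> l\<close> by (intro sum_mono disj) auto
    also have "\<dots> = N * D k l + (\<Sum>m\<in>UNIV - {k, l}. R m - D m k - D m l)"
      using c3 c2 inner by (simp add: sum.distrib N_def)
    also have "(\<Sum>m\<in>UNIV - {k, l}. R m - D m k - D m l)
        = (\<Sum>m\<in>UNIV. R m - D m k - D m l) - (\<Sum>m\<in>{k, l}. R m - D m k - D m l)"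
      by (rule sum_diff) auto
    also have "\<dots> = T - R k - R l - (R k + R l - D k l - D l k)"
      using \<open>k \<noteq> l\<close> by (simp add: sum_subtractf Rcol diag T_def)
    finally show ?thesis
      using sym[of l k] by (simp add: E_def algebra_simps)
  qed
  have row: "(\<Sum>l\<in>UNIV - {k}. E k l)
      = (N + 2) * R k + (n - 1) * (T - 2 * R k - N * (2 * \<theta>)) - 2 * (T - R k)" for k
  proof -
    have "(\<Sum>l\<in>UNIV. E k l) = (N + 2) * R k + n * (T - 2 * R k - N * (2 * \<theta>)) - 2 * T"
      unfolding E_def sum.distrib sum_subtractf sum_distrib_left[symmetric]
        R_def[symmetric] T_def[symmetric] by (simp add: n_def algebra_simps)
    then show ?thesis
      by (simp add: sum_remove_UNIV E_def diag algebra_simps)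
  qed
  have row_nonneg: "0 \<le> (\<Sum>l\<in>UNIV - {k}. E k l)" for k
    by (intro sum_nonneg E_nonneg) auto
  have total: "(\<Sum>k\<in>UNIV. \<Sum>l\<in>UNIV - {k}. E k l) = 2 * N * (T - n * (n - 1) * \<theta>)"
  proof -
    have "(\<Sum>k\<in>UNIV. \<Sum>l\<in>UNIV - {k}. E k l) =
        (\<Sum>k\<in>UNIV. (N + 4 - 2 * (n - 1)) * R k + ((n - 1) * (T - N * (2 * \<theta>)) - 2 * T))"
      by (intro sum.cong refl) (simp add: row algebra_simps)
    also have "\<dots> = (N + 4 - 2 * (n - 1)) * T + n * ((n - 1) * (T - N * (2 * \<theta>)) - 2 * T)"
      by (simp add: sum.distrib sum_distrib_left[symmetric] T_def n_def)
    also have "\<dots> = 2 * N * (T - n * (n - 1) * \<theta>)"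
      by (simp add: N_def algebra_simps)
    finally show ?thesis .
  qed
  have N: "N > 0" using n by (simp add: N_def)
  have "T \<le> n * (n - 1) * \<theta>" using tot by (simp add: T_def R_def n_def)
  moreover have "0 \<le> 2 * N * (T - n * (n - 1) * \<theta>)"
    unfolding total[symmetric] by (intro sum_nonneg row_nonneg)
  then have "T \<ge> n * (n - 1) * \<theta>"
    using N by (simp add: zero_le_mult_iff)
  ultimately have T: "T = n * (n - 1) * \<theta>" by simp
  then have "(\<Sum>k\<in>UNIV. \<Sum>l\<in>UNIV - {k}. E k l) = 0" using total by simp
  then have row0: "(\<Sum>l\<in>UNIV - {k}. E k l) = 0" for k
    using sum_nonneg_eq_0_iff[of UNIV "\<lambda>k. \<Sum>l\<in>UNIV - {k}. E k l"] row_nonneg by simp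
  have E0: "E k l = 0"
    using row0[of k] sum_nonneg_eq_0_iff[of "UNIV - {k}" "E k"] E_nonneg[of k] kl by auto
  \<comment> \<open>After inserting \<open>T\<close>, the coefficient of \<open>R k\<close> in the
    row equation is \<open>(n - 3) * (n - 4)\<close>. It is nonzero for \<open>n \<ge> 5\<close>,
    but would vanish for four indices, where every pair has just one disjoint partner.\<close>
  have Rk: "R k = (n - 1) * \<theta>" for k
  proof -
    have "(n - 3) * (n - 4) * (R k - (n - 1) * \<theta>) = 0"
      using row0[of k] unfolding row T N_def by (simp add: algebra_simps)
    then show ?thesis using n by simp
  qed
  have "(N + 2) * (D k l - \<theta>) = 0"
    using E0 unfolding E_def Rk T N_def by (simp add: algebra_simps)
  then show ?thesis using N by simp
qed

section \<open>Critical points of the uniform system\<close>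

text \<open>All coordinates are roots of one cubic without quadratic term. Two different values
  \<open>a\<close> and \<open>b\<close> thus satisfy \<open>a^2 + a b + b^2 = Q + 1\<close>, while
  \<open>Q\<close> is the sum of all the squares; this forces \<open>a b > 1\<close> and at most two
  values, and then counting multiplicities gives a contradiction.\<close>

lemma uniform_critical_points:
  fixes v :: "'n::finite \<Rightarrow> real"
  assumes n3: "CARD('n) \<ge> 3"
    and crit: "\<And>i. (\<Sum>j\<in>UNIV - {i}. v j * (v i * v j - 1)) = 0"
  shows "\<exists>t\<in>{0, 1, -1}. \<forall>i. v i = t"
proof -
  define Q where "Q = (\<Sum>j\<in>UNIV. (v j)\<^sup>2)"
  define S where "S = (\<Sum>j\<in>UNIV. v j)"
  have cubic: "v i * (Q - (v i)\<^sup>2) = S - v i" for i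
  proof -
    have "(\<Sum>j\<in>UNIV. v j * (v i * v j - 1)) = (\<Sum>j\<in>UNIV. v i * (v j)\<^sup>2 - v j)"
      by (intro sum.cong) (auto simp: algebra_simps power2_eq_square)
    also have "\<dots> = v i * Q - S"
      unfolding Q_def S_def sum_subtractf sum_distrib_left ..
    finally show ?thesis
      using crit[of i] unfolding sum_remove_UNIV by (simp add: algebra_simps power2_eq_square)
  qed
  have quad: "(v i)\<^sup>2 + v i * v j + (v j)\<^sup>2 = Q + 1" if "v i \<noteq> v j" for i j
  proof -
    have "(v i - v j) * ((v i)\<^sup>2 + v i * v j + (v j)\<^sup>2 - (Q + 1)) = 0"
      using cubic[of i] cubic[of j] by (simp add: algebra_simps power2_eq_square)
    then show ?thesis using that by simp
  qed
  have sumsq: "(\<Sum>x\<in>A. (v x)\<^sup>2) \<le> Q" for A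
    unfolding Q_def by (intro sum_mono2) auto
  \<comment> \<open>If one value occurs at \<open>i\<close> only, the summands of the equation at
    \<open>i\<close> are all equal and nonzero, so they cannot cancel.\<close>
  have single: False if b: "\<And>k. k \<noteq> i \<Longrightarrow> v k = b" and ab: "v i * b > 1" for i b
  proof -
    have "(\<Sum>j\<in>UNIV - {i}. v j * (v i * v j - 1)) = (\<Sum>j\<in>UNIV - {i}. b * (v i * b - 1))"
      using b by (intro sum.cong) auto
    then have "(real CARD('n) - 1) * (b * (v i * b - 1)) = 0"
      using crit[of i] by (simp add: sum_remove_UNIV algebra_simps)
    then show False using n3 ab by auto
  qed
  have const: "v i = v j" for i j
  proof (rule ccontr)
    assume ne: "v i \<noteq> v j"
    then have ij: "i \<noteq> j" by auto
    have third: "1 + (v k)\<^sup>2 \<le> v i * v j" if "k \<notin> {i, j}" for k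
      using sumsq[of "{i, j, k}"] quad[OF ne] that ij by (auto simp: insert_commute)
    have two: "v k = v i \<or> v k = v j" if k: "k \<notin> {i, j}" for k
    proof (rule ccontr)
      assume "\<not> ?thesis"
      then have "v i \<noteq> v k" "v j \<noteq> v k" by auto
      \<comment> \<open>Three distinct roots of a cubic without quadratic term sum to zero; the
        resulting \<open>v k\<close> is too large for \<open>third\<close>.\<close>
      then have "(v i - v j) * (v i + v j + v k) = 0"
        using quad[of i k] quad[of j k] by (simp add: algebra_simps power2_eq_square)
      then have "v k = - (v i + v j)" using ne by simp
      then have "(v k)\<^sup>2 = (v i + v j)\<^sup>2" by (simp only: power2_minus)
      then have "1 + (v i + v j)\<^sup>2 \<le> v i * v j" using third[OF k] by simp
      moreover have "v i * v j \<le> (v i + v j)\<^sup>2"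
        using zero_le_power2[of "v i + v j"] zero_le_power2[of "v i"] zero_le_power2[of "v j"]
        unfolding power2_sum by linarith
      ultimately show False by simp
    qed
    have "card (UNIV - {i, j}) \<noteq> 0"
      using n3 ij by (simp add: card_Diff_subset)
    then obtain k where k: "k \<notin> {i, j}"
      by (metis Diff_iff card.empty all_not_in_conv)
    have "v i * v j \<ge> 1" using third[OF k] by (smt (verit) zero_le_power2)
    then have "v i \<noteq> 0" "v j \<noteq> 0" by auto
    then have "(v k)\<^sup>2 > 0" using two[OF k] by auto
    then have gt: "v i * v j > 1" using third[OF k] by linarith
    \<comment> \<open>Either one of the two values occurs exactly once, which \<open>single\<close>
      excludes, or both occur at least twice, and then \<open>Q\<close> is too large for
      \<open>quad\<close>.\<close>
    consider "\<And>k. k \<notin> {i, j} \<Longrightarrow> v k = v j" | "\<And>k. k \<notin> {i, j} \<Longrightarrow> v k = v i"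
      | k l where "k \<notin> {i, j}" "l \<notin> {i, j}" "v k = v i" "v l = v j"
      using two by metis
    then show False
    proof cases
      case 1
      then show False using single[of i "v j"] gt by (metis insert_iff empty_iff)
    next
      case 2
      then show False using single[of j "v i"] gt by (metis insert_iff empty_iff mult.commute)
    next
      case 3
      then have "k \<noteq> l" using ne by auto
      then have "(v i)\<^sup>2 + (v j)\<^sup>2 + (v i)\<^sup>2 + (v j)\<^sup>2 \<le> Q"
        using sumsq[of "{i, j, k, l}"] 3 ij by (auto simp: insert_commute)
      then have "(v i)\<^sup>2 + (v j)\<^sup>2 < v i * v j" using quad[OF ne] by simp
      then show False
        using gt zero_le_power2[of "v i - v j"] by (simp add: power2_diff)
    qed
  qed
  obtain t where t: "\<And>i. v i = t" using const by blast
  have "(real CARD('n) - 1) * (t * (t * t - 1)) = 0"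
    using crit by (simp add: t sum_remove_UNIV algebra_simps)
  moreover have "real CARD('n) - 1 \<noteq> 0" using n3 by linarith
  ultimately have "t * (t * t - 1) = 0" using mult_eq_0_iff by blast
  then have "t * ((t - 1) * (t + 1)) = 0" by (simp add: algebra_simps)
  then have "t \<in> {0, 1, -1}" by auto
  then show ?thesis using t by blast
qed

section \<open>Instances and upper bounds on their distance to the degenerate set\<close>

definition inst_dist :: "real \<Rightarrow> real^'n^'n \<Rightarrow> real^'n \<Rightarrow> real^'n^'n \<Rightarrow> real^'n \<Rightarrow> real"
  where "inst_dist \<alpha> C us C' us' = \<alpha> * l1_norm_mat (C - C') + (1 - \<alpha>) * l1_norm_vec (us - us')"

lemma S_C_sym: "C \<in> S_C \<Longrightarrow> C $ i $ j = C $ j $ i"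
  unfolding S_C_def transpose_def by (auto simp: vec_eq_iff)

lemma S_C_nonneg: "C \<in> S_C \<Longrightarrow> 0 \<le> C $ i $ j"
  unfolding S_C_def by auto

lemma S_C_sum: "C \<in> S_C \<Longrightarrow> (\<Sum>i\<in>UNIV. \<Sum>j\<in>UNIV. C $ i $ j) = 1"
  unfolding S_C_def by auto

lemma S_C_I:
  assumes "\<And>i j. C $ i $ j = C $ j $ i" "\<And>i j. 0 \<le> C $ i $ j"
    "(\<Sum>i\<in>UNIV. \<Sum>j\<in>UNIV. C $ i $ j) = 1"
  shows "C \<in> S_C"
  using assms unfolding S_C_def transpose_def by (auto simp: vec_eq_iff)

lemma S_C_le_1:
  assumes "C \<in> S_C"
  shows "C $ i $ j \<le> 1"
  using member_le_double_sum[of UNIV i j "\<lambda>i j. C $ i $ j"] S_C_nonneg[OF assms] S_C_sum[OF assms]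
  by simp

lemma S_u_le_1:
  assumes "u \<in> S_u"
  shows "\<bar>u $ i\<bar> \<le> 1"
  using assms member_le_sum[of i UNIV "\<lambda>i. \<bar>u $ i\<bar>"] unfolding S_u_def l1_norm_vec_def by auto

lemma degenerate_setI:
  assumes "C \<in> S_C" "us \<in> S_u"
    and zero: "\<And>a b. C $ a $ b = 0 \<or> u $ a * u $ b = us $ a * us $ b"
    and ne: "u $ c * u $ d \<noteq> us $ c * us $ d"
  shows "(C, us) \<in> degenerate_set"
proof -
  have "C $ a $ b * (u $ a * u $ b - us $ a * us $ b)\<^sup>2 = 0" for a b
    using zero[of a b] by auto
  then have "mc_objective C us u = 0" unfolding mc_objective_def by (intro sum.neutral ballI)
  moreover have "outer u \<noteq> outer us" using ne by (auto simp: outer_def vec_eq_iff)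
  ultimately show ?thesis using assms unfolding degenerate_set_def by auto
qed

text \<open>Once the off-diagonal weight of row and column \<open>i\<close> sits at the diagonal
  entry, flipping the sign of \<open>us $ i\<close> changes no observed product. The nonzero entry
  at \<open>j\<close> ensures that the outer product does change. Removing the weight of row and
  column costs twice the row sum, and adding it to the diagonal costs the same again.\<close>

lemma isolate_node:
  fixes C :: "real^'n^'n" and us :: "real^'n"
  assumes C: "C \<in> S_C" and us: "us \<in> S_u" and i: "us $ i \<noteq> 0" and j: "us $ j \<noteq> 0" "j \<noteq> i"
  obtains C' where "(C', us) \<in> degenerate_set"
    "l1_norm_mat (C - C') \<le> 4 * (\<Sum>j\<in>UNIV - {i}. C $ i $ j)"
proof -
  define R where "R = (\<Sum>j\<in>UNIV - {i}. C $ i $ j)"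
  define C' :: "real^'n^'n" where "C' = (\<chi> a b. if a = i \<and> b = i then C $ i $ i + 2 * R
    else if a = i \<or> b = i then 0 else C $ a $ b)"
  have R: "R \<ge> 0" unfolding R_def by (intro sum_nonneg S_C_nonneg C)
  have R': "(\<Sum>j\<in>UNIV - {i}. C $ j $ i) = R" unfolding R_def
    by (intro sum.cong S_C_sym C refl)
  have "(\<Sum>a\<in>UNIV. \<Sum>b\<in>UNIV. C' $ a $ b) = (\<Sum>a\<in>UNIV. \<Sum>b\<in>UNIV. C $ a $ b)"
    unfolding double_sum_split_cross[of _ i]
    by (simp add: C'_def R' R_def[symmetric])
  then have "C' \<in> S_C"
    using R S_C_nonneg[OF C] S_C_sum[OF C] by (intro S_C_I) (auto simp: C'_def S_C_sym[OF C])
  moreover define u where "u = (\<chi> a. if a = i then - us $ i else us $ a)"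
  have "u $ i * u $ j \<noteq> us $ i * us $ j" using i j by (simp add: u_def)
  ultimately have deg: "(C', us) \<in> degenerate_set"
    using us by (intro degenerate_setI[of C' us u i j]) (auto simp: C'_def u_def)
  have "l1_norm_mat (C - C') = 4 * R"
    unfolding l1_norm_mat_def double_sum_split_cross[of _ i]
    using R by (simp add: C'_def abs_of_nonneg S_C_nonneg[OF C] R' R_def[symmetric])
  then show ?thesis using that[OF deg] by (simp add: R_def)
qed

text \<open>Supplies the nonvanishing entries that \<open>isolate_node\<close> requires, by mixing a
  little of a unit vector into \<open>us\<close> at a coordinate where it vanishes. The norm is then
  exactly preserved.\<close>

lemma perturb_two_nonzero:
  fixes us :: "real^'n"
  assumes us: "us \<in> S_u" and card: "CARD('n) \<ge> 2" and e: "0 < e" "e < 1"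
  obtains us' j where "us' \<in> S_u" "us' $ i \<noteq> 0" "us' $ j \<noteq> 0" "j \<noteq> i"
    "l1_norm_vec (us - us') \<le> 2 * e"
proof -
  have mix: "\<exists>us'. us' \<in> S_u \<and> us' $ k \<noteq> 0 \<and> (\<forall>j. us $ j \<noteq> 0 \<longrightarrow> us' $ j \<noteq> 0) \<and>
    l1_norm_vec (us - us') \<le> 2 * e" if k: "us $ k = 0" for k
  proof -
    define v :: "real^'n" where "v = (\<chi> j. (1 - e) * us $ j + (if j = k then e else 0))"
    have "\<bar>v $ j\<bar> = (1 - e) * \<bar>us $ j\<bar> + (if j = k then e else 0)" for j
      using e k by (simp add: v_def abs_mult)
    then have "l1_norm_vec v = 1"
      using us by (simp add: l1_norm_vec_def S_u_def sum.distrib sum_distrib_left[symmetric])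
    moreover have "\<bar>(us - v) $ j\<bar> = e * \<bar>us $ j\<bar> + (if j = k then e else 0)" for j
      using e k by (simp add: v_def abs_mult algebra_simps flip: right_diff_distrib)
    then have "l1_norm_vec (us - v) = 2 * e"
      using us by (simp add: l1_norm_vec_def S_u_def sum.distrib sum_distrib_left[symmetric])
    ultimately show ?thesis
      using e k by (intro exI[of _ v]) (auto simp: S_u_def v_def)
  qed
  show ?thesis
  proof (cases "us $ i = 0")
    case True
    obtain us' where us': "us' \<in> S_u" "us' $ i \<noteq> 0" "\<forall>j. us $ j \<noteq> 0 \<longrightarrow> us' $ j \<noteq> 0"
      "l1_norm_vec (us - us') \<le> 2 * e" using mix[OF True] by blast
    have "\<exists>j. us $ j \<noteq> 0"
    proof (rule ccontr)
      assume "\<not> ?thesis"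
      then have "l1_norm_vec us = 0" by (simp add: l1_norm_vec_def)
      then show False using us by (simp add: S_u_def)
    qed
    then show ?thesis using that us' True by blast
  next
    case False
    have "\<exists>k. k \<noteq> i"
    proof (rule ccontr)
      assume "\<not> ?thesis"
      then have "UNIV = {i}" by auto
      then have "CARD('n) = 1" by (metis card.empty card.insert empty_iff finite.emptyI One_nat_def)
      then show False using card by simp
    qed
    then obtain k where k: "k \<noteq> i" by blast
    show ?thesis
    proof (cases "us $ k = 0")
      case True
      then show ?thesis using mix[OF True] that False k by blast
    next
      case False': False
      show ?thesis using that[OF us False False' k] e by (simp add: l1_norm_vec_def)
    qed
  qed
qed

text \<open>The cost of isolating node \<open>i\<close> bounds the distance from above. The
  perturbation that makes this possible for every \<open>us\<close> is arbitrarily small and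
  disappears in the limit.\<close>

lemma row_sum_lower_bound:
  fixes C :: "real^'n^'n"
  assumes C: "C \<in> S_C" and us: "us \<in> S_u" and card: "CARD('n) \<ge> 2" and \<alpha>: "0 \<le> \<alpha>" "\<alpha> \<le> 1"
    and far: "\<And>C' us'. (C', us') \<in> degenerate_set \<Longrightarrow> d \<le> inst_dist \<alpha> C us C' us'"
  shows "d \<le> \<alpha> * (4 * (\<Sum>j\<in>UNIV - {i}. C $ i $ j))"
proof (rule field_le_epsilon)
  fix e :: real assume e: "e > 0"
  define e' where "e' = min (1/2) (e/2)"
  have e': "0 < e'" "e' < 1" "2 * e' \<le> e" using e by (auto simp: e'_def min_def)
  obtain us' j where us': "us' \<in> S_u" "us' $ i \<noteq> 0" "us' $ j \<noteq> 0" "j \<noteq> i"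
    "l1_norm_vec (us - us') \<le> 2 * e'"
    using perturb_two_nonzero[OF us card e'(1,2)] by metis
  obtain C' where C': "(C', us') \<in> degenerate_set"
    "l1_norm_mat (C - C') \<le> 4 * (\<Sum>j\<in>UNIV - {i}. C $ i $ j)"
    using isolate_node[OF C us'(1-4)] by metis
  have "d \<le> \<alpha> * l1_norm_mat (C - C') + (1 - \<alpha>) * l1_norm_vec (us - us')"
    using far[OF C'(1)] by (simp add: inst_dist_def)
  also have "\<dots> \<le> \<alpha> * (4 * (\<Sum>j\<in>UNIV - {i}. C $ i $ j)) + 1 * e"
    using \<alpha> C'(2) us'(5) e' by (intro add_mono mult_left_mono mult_mono) (auto simp: l1_norm_vec_def sum_nonneg)
  finally show "d \<le> \<alpha> * (4 * (\<Sum>j\<in>UNIV - {i}. C $ i $ j)) + e" by simp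
qed

text \<open>Adjacency matrix of one undirected edge. The products of indicators let double sums
  factor, and the entries sum to 2 even when \<open>k = l\<close>.\<close>

definition edge :: "'n \<Rightarrow> 'n \<Rightarrow> 'n \<Rightarrow> 'n \<Rightarrow> real"
  where "edge k l a b = of_bool (a = k) * of_bool (b = l) + of_bool (a = l) * of_bool (b = k)"

lemma sum_edge: "(\<Sum>a\<in>UNIV. \<Sum>b\<in>UNIV. edge k l a (b::'n::finite)) = 2"
  unfolding edge_def sum.distrib sum_distrib_left[symmetric] sum_distrib_right[symmetric]
  by simp

text \<open>Concentrating \<open>us\<close> on four indices and moving the weight of the edges
  \<open>kl\<close> and \<open>mp\<close> onto \<open>km\<close> yields a degenerate instance. Each
  unit of edge weight moved counts four times in the matrix norm (removed and added, in two
  symmetric entries), and the mass of \<open>us\<close> outside the four indices counts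
  twice.\<close>

lemma edge_bipartite_bound:
  fixes C :: "real^'n^'n" and us :: "real^'n"
  assumes C: "C \<in> S_C" and us: "us \<in> S_u" and \<alpha>: "0 \<le> \<alpha>" "\<alpha> \<le> 1"
    and diag: "\<And>i. C $ i $ i = 0"
    and dist: "distinct [k, l, m, p]"
    and far: "\<And>C' us'. (C', us') \<in> degenerate_set \<Longrightarrow> d \<le> inst_dist \<alpha> C us C' us'"
  shows "d \<le> \<alpha> * (4 * (C $ k $ l + C $ m $ p)) +
    (1 - \<alpha>) * (2 * (1 - (\<bar>us $ k\<bar> + \<bar>us $ l\<bar> + \<bar>us $ m\<bar> + \<bar>us $ p\<bar>)))"
proof -
  define x y where "x = C $ k $ l" and "y = C $ m $ p"
  have xy: "x \<ge> 0" "y \<ge> 0" unfolding x_def y_def by (simp_all add: S_C_nonneg[OF C])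
  define C' :: "real^'n^'n" where
    "C' = (\<chi> a b. C $ a $ b - x * edge k l a b - y * edge m p a b + (x + y) * edge k m a b)"
  have "(\<Sum>a\<in>UNIV. \<Sum>b\<in>UNIV. C' $ a $ b) = 1 - x * 2 - y * 2 + (x + y) * 2"
    unfolding sum_edge[symmetric, of k l] 
    by (simp add: C'_def sum.distrib sum_subtractf sum_distrib_left[symmetric] sum_edge S_C_sum[OF C])
  moreover have edge_sym: "edge k l a b = edge k l b a" for k l a b :: 'n
    by (simp add: edge_def)
  have "C' $ a $ b = C' $ b $ a" for a b
    unfolding C'_def using S_C_sym[OF C, of a b] edge_sym[of _ _ a b] by simp
  moreover have "0 \<le> C' $ a $ b" for a b
    using dist xy S_C_nonneg[OF C, of a b] S_C_sym[OF C]
    by (auto simp: C'_def edge_def x_def y_def)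
  ultimately have C'S: "C' \<in> S_C" by (intro S_C_I) auto
  define S where "S = {k, l, m, p}"
  define r where "r = 1 - (\<Sum>a\<in>S. \<bar>us $ a\<bar>)"
  have out: "(\<Sum>a\<in>UNIV - S. \<bar>us $ a\<bar>) = r"
    using us sum_diff[of UNIV S "\<lambda>a. \<bar>us $ a\<bar>"] by (simp add: r_def S_u_def l1_norm_vec_def)
  then have r: "r \<ge> 0" by (metis sum_nonneg abs_ge_zero)
  \<comment> \<open>The mass \<open>r\<close> lost outside \<open>S\<close> is added at
    \<open>k\<close> with the sign of \<open>us $ k\<close>, so that the norm remains 1.\<close>
  define us' :: "real^'n" where "us' = (\<chi> a. if a = k then us $ k + (if us $ k \<ge> 0 then r else - r)
    else if a \<in> S then us $ a else 0)"
  have split: "sum f UNIV = sum f S + sum f (UNIV - S)" for f :: "'n \<Rightarrow> real"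
    by (simp add: sum_diff)
  have S4: "sum f S = f k + f l + f m + f p" for f :: "'n \<Rightarrow> real"
    using dist by (simp add: S_def)
  have kS: "k \<in> S" "l \<in> S" "m \<in> S" "p \<in> S" "l \<noteq> k" "m \<noteq> k" "p \<noteq> k" using dist by (auto simp: S_def)
  have outk: "a \<in> UNIV - S \<Longrightarrow> us' $ a = 0" for a using kS by (auto simp: us'_def)
  have usk: "\<bar>us' $ k\<bar> = \<bar>us $ k\<bar> + r" using r by (simp add: us'_def)
  have "l1_norm_vec us' = 1"
    unfolding l1_norm_vec_def split S4 usk using kS outk by (simp add: us'_def r_def S4)
  then have us'S: "us' \<in> S_u" by (simp add: S_u_def)
  have "\<bar>(us - us') $ k\<bar> = r" using r by (simp add: us'_def)
  moreover have "(\<Sum>a\<in>UNIV - S. \<bar>(us - us') $ a\<bar>) = r" using outk out by simp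
  ultimately have dv: "l1_norm_vec (us - us') = 2 * r"
    unfolding l1_norm_vec_def split S4 using kS by (simp add: us'_def)
  have edge_nn: "edge k l a b \<ge> 0" for k l a b :: 'n by (simp add: edge_def)
  have "l1_norm_mat (C - C') \<le> (\<Sum>a\<in>UNIV. \<Sum>b\<in>UNIV. x * edge k l a b + y * edge m p a b + (x + y) * edge k m a b)"
    unfolding l1_norm_mat_def
  proof (intro sum_mono)
    fix a b
    have "0 \<le> x * edge k l a b" "0 \<le> y * edge m p a b" "0 \<le> (x + y) * edge k m a b"
      using xy edge_nn by auto
    then show "\<bar>(C - C') $ a $ b\<bar> \<le> x * edge k l a b + y * edge m p a b + (x + y) * edge k m a b"
      by (simp add: C'_def)
  qed
  also have "\<dots> = 4 * (x + y)"
    by (simp add: sum.distrib sum_distrib_left[symmetric] sum_edge)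
  finally have dm: "l1_norm_mat (C - C') \<le> 4 * (x + y)" .
  \<comment> \<open>On \<open>S\<close> the remaining edges join \<open>{k, l}\<close> to \<open>{m, p}\<close>, so the two sides may be scaled inversely.\<close>
  define u :: "real^'n" where "u = (\<chi> a. if a \<in> {k, l} then 2 * us' $ a else us' $ a / 2)"
  have "\<exists>a\<in>S. us' $ a \<noteq> 0"
  proof (rule ccontr)
    assume "\<not> ?thesis"
    then have "us' $ a = 0" for a using outk[of a] by blast
    then show False using us'S by (simp add: S_u_def l1_norm_vec_def)
  qed
  then obtain c where c: "us' $ c \<noteq> 0" by blast
  \<comment> \<open>A diagonal entry already separates the outer products: scaling by 2 or 1/2
    changes every nonzero square.\<close>
  have "u $ c * u $ c \<noteq> us' $ c * us' $ c" using c by (auto simp: u_def)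
  moreover have "C' $ a $ b = 0 \<or> u $ a * u $ b = us' $ a * us' $ b" for a b
  proof (cases "a \<in> S \<and> b \<in> S")
    case False
    then show ?thesis using outk by (auto simp: u_def)
  next
    case True
    have "C' $ a $ b = 0" if "a \<in> {k, l} \<longleftrightarrow> b \<in> {k, l}"
      using True that dist S_C_sym[OF C]
      by (auto simp: S_def C'_def edge_def diag x_def y_def)
    then show ?thesis by (auto simp: u_def)
  qed
  ultimately have "(C', us') \<in> degenerate_set"
    by (intro degenerate_setI[OF C'S us'S]) auto
  then have "d \<le> \<alpha> * l1_norm_mat (C - C') + (1 - \<alpha>) * l1_norm_vec (us - us')"
    using far by (simp add: inst_dist_def)
  also have "\<dots> \<le> \<alpha> * (4 * (x + y)) + (1 - \<alpha>) * (2 * r)"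
    unfolding dv using \<alpha> dm by (intro add_mono mult_left_mono) auto
  finally show ?thesis by (simp add: x_def y_def r_def S4)
qed

section \<open>The balancing value of \<alpha> and the farthest instances\<close>

text \<open>The numerator is \<open>(n - 1) * (n - 4)\<close> and the denominator exceeds it by
  \<open>2 * (n - 3)\<close>. The last identity states the ratio of \<alpha> to 1 - \<alpha> in the
  form needed for balancing the two kinds of cost.\<close>

lemma alpha_bounds:
  fixes n \<alpha> :: real
  assumes "n \<ge> 5" and "\<alpha> = (n\<^sup>2 - 5 * n + 4) / (n\<^sup>2 - 3 * n - 2)"
  shows "0 < \<alpha>" "\<alpha> < 1" "(1 - \<alpha>) * ((n - 1) * (n - 4)) = 2 * \<alpha> * (n - 3)"
proof -
  \<comment> \<open>This bounds \<open>n\<^sup>2\<close> below by \<open>10 * n - 25\<close>, which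
    makes both positivity claims linear in \<open>n\<close>.\<close>
  have "(n - 5) * (n - 5) \<ge> 0" by simp
  then have num: "n\<^sup>2 - 5 * n + 4 > 0" and den: "n\<^sup>2 - 3 * n - 2 > 0"
    using assms(1) by (auto simp: power2_eq_square algebra_simps)
  then show "0 < \<alpha>" using assms by simp
  show "\<alpha> < 1" using den assms by simp
  have "\<alpha> * (n\<^sup>2 - 3 * n - 2) = n\<^sup>2 - 5 * n + 4"
    unfolding assms(2) using den by simp
  then have num_eq: "\<alpha> * (n\<^sup>2 - 3 * n - 2) = (n - 1) * (n - 4)"
    by (simp add: power2_eq_square algebra_simps)
  then have "(1 - \<alpha>) * (n\<^sup>2 - 3 * n - 2) = 2 * (n - 3)" by (simp add: power2_eq_square algebra_simps)
  then have "(1 - \<alpha>) * (\<alpha> * (n\<^sup>2 - 3 * n - 2)) = 2 * \<alpha> * (n - 3)"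
    by (metis mult.assoc mult.left_commute)
  then show "(1 - \<alpha>) * ((n - 1) * (n - 4)) = 2 * \<alpha> * (n - 3)"
    unfolding num_eq .
qed

text \<open>The row bounds add up to the total weight 1, so they are tight and the diagonal
  vanishes. The bounds for disjoint edges then have the shape required by
  \<open>kneser_extremal\<close> after a correction by the moduli of \<open>us\<close>.\<close>

lemma farthest_instance:
  fixes C :: "real^'n^'n" and us :: "real^'n"
  defines "n \<equiv> real CARD('n)"
  assumes card: "CARD('n) \<ge> 5" and \<alpha>_def: "\<alpha> = (n\<^sup>2 - 5 * n + 4) / (n\<^sup>2 - 3 * n - 2)"
    and C: "C \<in> S_C" and us: "us \<in> S_u"
    and far: "\<And>C' us'. (C', us') \<in> degenerate_set \<Longrightarrow> 4 * \<alpha> / n \<le> inst_dist \<alpha> C us C' us'"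
  shows "C $ i $ j = (if i = j then 0 else 1 / (n * (n - 1)))" "\<bar>us $ i\<bar> = 1 / n"
proof -
  have n: "n \<ge> 5" using card by (simp add: n_def)
  note \<alpha> = alpha_bounds[OF n \<alpha>_def]
  have card2: "CARD('n) \<ge> 2" using card by simp
  define R where "R i = (\<Sum>j\<in>UNIV - {i}. C $ i $ j)" for i
  have R_ge: "1 / n \<le> R i" for i
  proof -
    have "4 * \<alpha> / n \<le> \<alpha> * (4 * R i)"
      unfolding R_def by (rule row_sum_lower_bound[OF C us card2 _ _ far]) (use \<alpha> in auto)
    then have "(4 * \<alpha>) * (1 / n) \<le> (4 * \<alpha>) * R i" by simp
    then show ?thesis using \<alpha>(1) by (subst (asm) mult_le_cancel_left_pos) auto
  qed
  have "(\<Sum>i\<in>UNIV. C $ i $ i + (R i - 1 / n)) = (\<Sum>i\<in>UNIV. (\<Sum>j\<in>UNIV. C $ i $ j) - 1 / n)"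
    by (intro sum.cong refl) (simp add: R_def sum_remove_UNIV)
  also have "\<dots> = 0"
    using n unfolding sum_subtractf S_C_sum[OF C] by (simp add: n_def)
  finally have s0: "(\<Sum>i\<in>UNIV. C $ i $ i + (R i - 1 / n)) = 0" .
  have "C $ i $ i + (R i - 1 / n) = 0" for i
    using s0 sum_nonneg_eq_0_iff[of UNIV "\<lambda>i. C $ i $ i + (R i - 1 / n)"]
      S_C_nonneg[OF C] R_ge by (simp add: add_nonneg_nonneg)
  then have diag: "C $ i $ i = 0" and R: "R i = 1 / n" for i
    using S_C_nonneg[OF C, of i i] R_ge[of i] by (smt (verit))+
  have rowsum: "(\<Sum>j\<in>UNIV. C $ i $ j) = 1 / n" for i
    using R[of i] diag[of i] by (simp add: R_def sum_remove_UNIV)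
  define c where "c = (1 - \<alpha>) / (2 * \<alpha>)"
  have c: "c * ((n - 1) * (n - 4)) = n - 3" "2 * \<alpha> * c = 1 - \<alpha>" "c > 0"
    using \<alpha> by (auto simp: c_def field_simps)
  \<comment> \<open>With \<open>c\<close> as the price of mass in \<open>us\<close> relative to edge
    weight, the part of the edge bound that depends on \<open>us\<close> splits over the two edges.
    The bound becomes \<open>D k l + D m p \<ge> 1 / n - c\<close>.\<close>
  define D where "D k l = (if k = l then 0 else C $ k $ l - c * (\<bar>us $ k\<bar> + \<bar>us $ l\<bar>))" for k l
  have D_diag: "D k k = 0" for k by (simp add: D_def)
  define \<theta> where "\<theta> = (1 / n - c) / 2"
  have two_\<theta>: "2 * \<theta> = 1 / n - c" by (simp add: \<theta>_def)
  have usum: "(\<Sum>l\<in>UNIV. \<bar>us $ l\<bar>) = 1" using us by (simp add: S_u_def l1_norm_vec_def)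
  have Drow: "(\<Sum>l\<in>UNIV. D k l) = 1 / n - c * ((n - 2) * \<bar>us $ k\<bar> + 1)" for k
  proof -
    have "(\<Sum>l\<in>UNIV. D k l) = (\<Sum>l\<in>UNIV - {k}. D k l)"
      by (simp add: sum_remove_UNIV D_diag)
    also have "\<dots> = (\<Sum>l\<in>UNIV - {k}. C $ k $ l - c * (\<bar>us $ k\<bar> + \<bar>us $ l\<bar>))"
      by (intro sum.cong) (auto simp: D_def)
    also have "\<dots> = 1 / n - c * ((n * \<bar>us $ k\<bar> + 1) - 2 * \<bar>us $ k\<bar>)"
      unfolding sum_subtractf sum_remove_UNIV rowsum diag sum_distrib_left[symmetric]
        sum.distrib usum by (simp add: n_def algebra_simps)
    also have "(n * \<bar>us $ k\<bar> + 1) - 2 * \<bar>us $ k\<bar> = (n - 2) * \<bar>us $ k\<bar> + 1"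
      by (simp add: algebra_simps)
    finally show ?thesis .
  qed
  have "2 * \<theta> \<le> D k l + D m p" if d: "distinct [k, l, m, p]" for k l m p
  proof -
    define s where "s = \<bar>us $ k\<bar> + \<bar>us $ l\<bar> + \<bar>us $ m\<bar> + \<bar>us $ p\<bar>"
    have "4 * \<alpha> / n \<le> \<alpha> * (4 * (C $ k $ l + C $ m $ p)) + (1 - \<alpha>) * (2 * (1 - s))"
      unfolding s_def by (rule edge_bipartite_bound[OF C us _ _ diag d far]) (use \<alpha> in auto)
    then have "(4 * \<alpha>) * (1 / n) \<le> (4 * \<alpha>) * (C $ k $ l + C $ m $ p + c * (1 - s))"
      unfolding c(2)[symmetric] by (simp add: algebra_simps)
    then have "1 / n \<le> C $ k $ l + C $ m $ p + c * (1 - s)"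
      using \<alpha>(1) by (subst (asm) mult_le_cancel_left_pos) auto
    then show ?thesis using d unfolding two_\<theta> by (simp add: D_def s_def algebra_simps)
  qed
  moreover have "(\<Sum>k\<in>UNIV. \<Sum>l\<in>UNIV. D k l) \<le> n * (n - 1) * \<theta>"
  proof -
    have "(\<Sum>k\<in>UNIV. \<Sum>l\<in>UNIV. D k l) = 1 - c * ((n - 2) + n)"
      unfolding Drow sum_subtractf sum_distrib_left[symmetric] sum.distrib usum
      using n by (simp add: n_def)
    also have "\<dots> = n * (n - 1) * \<theta>"
    proof -
      have "n * (n - 1) * \<theta> = (n - 1) / 2 - c * (n * (n - 1)) / 2"
        using n by (simp add: \<theta>_def field_simps)
      \<comment> \<open>The specific value of \<alpha> enters here: it makes the average of
        \<open>D\<close> over off-diagonal entries exactly \<theta>, leaving no slack.\<close>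
      moreover have "c * (n * (n - 1)) = (n - 3) + 4 * c * (n - 1)"
        using c(1) by (simp add: algebra_simps)
      ultimately show ?thesis by (simp add: field_simps)
    qed
    finally show ?thesis by simp
  qed
  ultimately have D: "D k l = \<theta>" if "k \<noteq> l" for k l
    using that kneser_extremal[OF card, of D \<theta> k l] S_C_sym[OF C]
    by (simp add: D_def n_def add.commute)
  have "(\<Sum>l\<in>UNIV. D k l) = (n - 1) * \<theta>" for k
  proof -
    have "(\<Sum>l\<in>UNIV. D k l) = (\<Sum>l\<in>UNIV - {k}. D k l)"
      by (simp add: sum_remove_UNIV D_diag)
    also have "\<dots> = (\<Sum>l\<in>UNIV - {k}. \<theta>)" by (intro sum.cong) (auto simp: D)
    finally show ?thesis by (simp add: sum_remove_UNIV n_def algebra_simps)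
  qed
  \<comment> \<open>The row sums of \<open>D\<close> are all equal, but by \<open>Drow\<close> they
    are affine in \<open>\<bar>us $ k\<bar>\<close> with nonzero slope, so the moduli
    coincide.\<close>
  then have eq: "c * ((n - 2) * \<bar>us $ k\<bar> + 1) = 1 / n - (n - 1) * \<theta>" for k
    unfolding Drow by (metis diff_diff_eq2 add_diff_cancel_left' diff_add_cancel)
  obtain t where t: "\<And>k. \<bar>us $ k\<bar> = t"
  proof
    fix k
    have "c * ((n - 2) * \<bar>us $ k\<bar> + 1) = c * ((n - 2) * \<bar>us $ i\<bar> + 1)"
      using eq[of k] eq[of i] by (rule trans[OF _ sym])
    then show "\<bar>us $ k\<bar> = \<bar>us $ i\<bar>" using c(3) n by simp
  qed
  then have uk: "\<bar>us $ k\<bar> = 1 / n" for k using usum n by (simp add: n_def field_simps)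
  then show "\<bar>us $ i\<bar> = 1 / n" .
  have "C $ i $ j = 1 / (n * (n - 1))" if "i \<noteq> j"
  proof -
    have Ck: "C $ i $ k = \<theta> + 2 * c / n" if "i \<noteq> k" for k
      using D[OF that] that by (simp add: D_def uk)
    have "1 / n = (\<Sum>k\<in>UNIV - {i}. C $ i $ k)" using R[of i] by (simp add: R_def)
    also have "\<dots> = (\<Sum>k\<in>UNIV - {i}. \<theta> + 2 * c / n)" using Ck by (intro sum.cong) auto
    also have "\<dots> = (n - 1) * (\<theta> + 2 * c / n)"
      by (simp add: sum_remove_UNIV n_def algebra_simps)
    finally show ?thesis using Ck[OF that] n by (simp add: field_simps)
  qed
  then show "C $ i $ j = (if i = j then 0 else 1 / (n * (n - 1)))" using diag by simp
qed

section \<open>Directional derivatives and criticality conditions\<close>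

lemma GDERIV_along_line:
  fixes f :: "'a::real_inner \<Rightarrow> real"
  assumes "GDERIV f (u + t *\<^sub>R h) :> g"
  shows "((\<lambda>t. f (u + t *\<^sub>R h)) has_real_derivative (h \<bullet> g)) (at t)"
proof -
  have "((\<lambda>t. u + t *\<^sub>R h) has_derivative (\<lambda>s. s *\<^sub>R h)) (at t)"
    by (auto intro!: derivative_eq_intros)
  from has_derivative_compose[OF this assms[unfolded gderiv_def]]
  show ?thesis by (simp add: has_field_derivative_def mult.commute[of _ "h \<bullet> g"] mult_commute_abs)
qed

lemma mc_objective_along_line_deriv:
  fixes C :: "real^'n^'n"
  defines "r \<equiv> \<lambda>us u i j. u $ i * u $ j - us $ i * us $ j"
    and "a \<equiv> \<lambda>u h i j. u $ i * h $ j + h $ i * u $ j"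
  shows "((\<lambda>t. mc_objective C us (u + t *\<^sub>R h)) has_real_derivative
    (\<Sum>i\<in>UNIV. \<Sum>j\<in>UNIV. C $ i $ j *
      (2 * (r us u i j + t * a u h i j + t\<^sup>2 * (h $ i * h $ j)) * (a u h i j + 2 * t * (h $ i * h $ j))))) (at t)"
proof -
  have "mc_objective C us (u + t *\<^sub>R h) = (\<Sum>i\<in>UNIV. \<Sum>j\<in>UNIV. C $ i $ j *
      (r us u i j + t * a u h i j + t\<^sup>2 * (h $ i * h $ j))\<^sup>2)" for t
    unfolding mc_objective_def r_def a_def
    by (simp add: algebra_simps power2_eq_square)
  then show ?thesis
    by (auto intro!: derivative_eq_intros sum.cong simp: power2_eq_square)
qed

text \<open>Along a line the objective is a polynomial in \<open>t\<close>. The two sums are half of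
  its first and second derivatives at 0, which the gradient and the Hessian determine.\<close>

lemma second_order_critical_mc:
  fixes C :: "real^'n^'n"
  assumes crit: "second_order_critical (mc_objective C us) u"
  shows "(\<Sum>i\<in>UNIV. \<Sum>j\<in>UNIV. C $ i $ j * ((u $ i * u $ j - us $ i * us $ j)
      * (u $ i * h $ j + h $ i * u $ j))) = 0" (is "?A = 0")
    and "0 \<le> (\<Sum>i\<in>UNIV. \<Sum>j\<in>UNIV. C $ i $ j * ((u $ i * h $ j + h $ i * u $ j)\<^sup>2
      + 2 * ((u $ i * u $ j - us $ i * us $ j) * (h $ i * h $ j))))" (is "0 \<le> ?B")
proof -
  define f where "f = mc_objective C us"
  define p where "p t = (\<Sum>i\<in>UNIV. \<Sum>j\<in>UNIV. C $ i $ j *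
      (2 * ((u $ i * u $ j - us $ i * us $ j) + t * (u $ i * h $ j + h $ i * u $ j)
        + t\<^sup>2 * (h $ i * h $ j)) * ((u $ i * h $ j + h $ i * u $ j) + 2 * t * (h $ i * h $ j))))" for t
  have p: "((\<lambda>t. f (u + t *\<^sub>R h)) has_real_derivative p t) (at t)" for t
    unfolding f_def p_def by (rule mc_objective_along_line_deriv)
  have "GDERIV f (u + 0 *\<^sub>R h) :> 0"
    using crit by (simp add: second_order_critical_def f_def)
  then have "p 0 = h \<bullet> 0"
    using DERIV_unique[OF p GDERIV_along_line] by blast
  moreover have "p 0 = 2 * ?A"
    unfolding p_def sum_distrib_left by (intro sum.cong refl) simp
  ultimately show "?A = 0" by simp
  obtain G H where G: "\<forall>\<^sub>F y in nhds u. GDERIV f y :> G y"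
    and H: "(G has_derivative (\<lambda>h. H *v h)) (at u)" and psd: "psd H"
    using crit by (auto simp: second_order_critical_def has_hessian_def f_def)
  \<comment> \<open>The gradient field \<open>G\<close> is available only near \<open>u\<close>.
    Hence \<open>p\<close> is identified with it only for \<open>t\<close> near 0, which suffices
    for the derivative there.\<close>
  have "((\<lambda>t. u + t *\<^sub>R h) \<longlongrightarrow> u + 0 *\<^sub>R h) (nhds 0)"
    by (intro tendsto_intros filterlim_ident)
  then have "filterlim (\<lambda>t. u + t *\<^sub>R h) (nhds u) (nhds 0)" by simp
  from eventually_compose_filterlim[OF G this]
  have ev: "\<forall>\<^sub>F t in nhds 0. p t = h \<bullet> G (u + t *\<^sub>R h)"
    by eventually_elim (use DERIV_unique[OF p GDERIV_along_line] in blast)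
  have "((\<lambda>t. u + t *\<^sub>R h) has_derivative (\<lambda>s. s *\<^sub>R h)) (at 0)"
    by (auto intro!: derivative_eq_intros)
  from has_derivative_compose[OF this, of G "\<lambda>h. H *v h"] H
  have "((\<lambda>t. G (u + t *\<^sub>R h)) has_derivative (\<lambda>s. H *v (s *\<^sub>R h))) (at 0)" by simp
  from has_derivative_inner_right[OF this, of h]
  have "((\<lambda>t. h \<bullet> G (u + t *\<^sub>R h)) has_real_derivative h \<bullet> (H *v h)) (at 0)"
    by (simp add: has_field_derivative_def matrix_vector_mult_scaleR mult_commute_abs)
  then have "(p has_real_derivative h \<bullet> (H *v h)) (at 0)"
    using DERIV_cong_ev[OF refl ev refl] by blast
  moreover have "(p has_real_derivative 2 * ?B) (at 0)"
    unfolding p_def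
    by (auto intro!: derivative_eq_intros sum.cong simp: sum_distrib_left power2_eq_square algebra_simps)
  ultimately have "2 * ?B = h \<bullet> (H *v h)" using DERIV_unique by blast
  moreover have "0 \<le> h \<bullet> (H *v h)" using psd by (simp add: psd_def)
  ultimately show "0 \<le> ?B" by linarith
qed

text \<open>The first-order condition in a coordinate direction gives a row sum plus a column sum;
  they agree by symmetry of \<open>C\<close>.\<close>

lemma critical_gradient:
  fixes C :: "real^'n^'n"
  assumes crit: "second_order_critical (mc_objective C us) u" and C: "C \<in> S_C"
  shows "(\<Sum>j\<in>UNIV. C $ i $ j * (u $ i * u $ j - us $ i * us $ j) * u $ j) = 0"
proof -
  define r where "r a b = C $ a $ b * (u $ a * u $ b - us $ a * us $ b)" for a b
  have r_sym: "r a b = r b a" for a b using S_C_sym[OF C] by (simp add: r_def mult_ac)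
  have "0 = (\<Sum>a\<in>UNIV. \<Sum>b\<in>UNIV. r a b * u $ a * of_bool (b = i) + of_bool (a = i) * (r a b * u $ b))"
    unfolding second_order_critical_mc(1)[OF crit, of "axis i 1", symmetric]
    by (intro sum.cong refl) (simp add: r_def axis_def algebra_simps)
  also have "\<dots> = (\<Sum>a\<in>UNIV. r a i * u $ a) + (\<Sum>b\<in>UNIV. r i b * u $ b)"
    unfolding sum.distrib sum_distrib_left[symmetric] by simp
  also have "(\<Sum>a\<in>UNIV. r a i * u $ a) = (\<Sum>b\<in>UNIV. r i b * u $ b)"
    by (intro sum.cong refl) (simp add: r_sym[of _ i])
  finally show ?thesis by (simp add: r_def)
qed

section \<open>Critical points at and near the extremal instances\<close>

lemma obtain_three:
  fixes i :: "'n::finite"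
  assumes "CARD('n) \<ge> 3"
  obtains j l where "j \<noteq> i" "l \<noteq> i" "j \<noteq> l"
proof -
  have "card (UNIV - {i}) \<ge> 2" using assms by (simp add: card_Diff_subset)
  then obtain T where T: "T \<subseteq> UNIV - {i}" "card T = 2" by (metis obtain_subset_with_card_n)
  then obtain j l where "T = {j, l}" "j \<noteq> l" by (auto simp: card_2_iff)
  then show ?thesis using T that by auto
qed

text \<open>As the moduli of \<open>us\<close> are constant, the quotients
  \<open>u $ i / us $ i\<close> solve the uniform system. Its solution 0 is excluded by negative
  curvature in the direction \<open>us\<close>.\<close>

lemma critical_points_uniform_instance:
  fixes C :: "real^'n^'n" and \<kappa> s :: real
  assumes card: "CARD('n) \<ge> 3"
    and C: "\<And>i j. C $ i $ j = (if i = j then 0 else \<kappa>)" and \<kappa>: "\<kappa> > 0"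
    and us: "\<And>i. \<bar>us $ i\<bar> = s" and s: "s > 0"
    and grad: "\<And>i. (\<Sum>j\<in>UNIV. C $ i $ j * (u $ i * u $ j - us $ i * us $ j) * u $ j) = 0"
    and hess: "0 \<le> (\<Sum>i\<in>UNIV. \<Sum>j\<in>UNIV. C $ i $ j * ((u $ i * us $ j + us $ i * u $ j)\<^sup>2
      + 2 * ((u $ i * u $ j - us $ i * us $ j) * (us $ i * us $ j))))"
  shows "u = us \<or> u = - us"
proof -
  define v where "v i = u $ i / us $ i" for i
  have us0: "us $ i \<noteq> 0" for i using us[of i] s by auto
  have us2: "us $ i * us $ i = s\<^sup>2" for i using us[of i] by (metis power2_abs power2_eq_square)
  have u: "u $ i = us $ i * v i" for i using us0[of i] by (simp add: v_def)
  have "(\<Sum>j\<in>UNIV - {i}. v j * (v i * v j - 1)) = 0" for i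
  proof -
    have "0 = (\<Sum>j\<in>UNIV - {i}. C $ i $ j * (u $ i * u $ j - us $ i * us $ j) * u $ j)"
      using grad[of i] C[of i i] by (simp add: sum_remove_UNIV)
    also have "\<dots> = (\<Sum>j\<in>UNIV - {i}. (\<kappa> * us $ i * (us $ j * us $ j)) * (v j * (v i * v j - 1)))"
      by (intro sum.cong refl) (auto simp: C u algebra_simps)
    also have "\<dots> = (\<Sum>j\<in>UNIV - {i}. (\<kappa> * us $ i * s\<^sup>2) * (v j * (v i * v j - 1)))"
      unfolding us2 ..
    finally show ?thesis using \<kappa> us0[of i] s by (simp flip: sum_distrib_left)
  qed
  then obtain t where t: "t \<in> {0, 1, -1}" "\<And>i. v i = t"
    using uniform_critical_points[OF card] by metis
  have "t \<noteq> 0"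
  proof
    assume "t = 0"
    then have u0: "u $ i = 0" for i using u t by simp
    define q where "q i j = 2 * C $ i $ j * (us $ i * us $ j)\<^sup>2" for i j
    have q: "0 \<le> q i j" for i j using \<kappa> by (simp add: q_def C)
    have "0 \<le> (\<Sum>i\<in>UNIV. \<Sum>j\<in>UNIV. - q i j)"
      using hess by (simp add: u0 q_def power2_eq_square mult_ac)
    then have q_le: "(\<Sum>i\<in>UNIV. \<Sum>j\<in>UNIV. q i j) \<le> 0" by (simp add: sum_negf)
    moreover obtain i j :: 'n where ij: "i \<noteq> j"
      using obtain_three[OF card] by metis
    have "q i j \<le> (\<Sum>i\<in>UNIV. \<Sum>j\<in>UNIV. q i j)"
      using q by (intro member_le_double_sum) auto
    moreover have "q i j > 0" using ij \<kappa> us0 by (simp add: q_def C)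
    ultimately show False using q_le by simp
  qed
  then have "t = 1 \<or> t = -1" using t by auto
  then show ?thesis using u t by (auto simp: vec_eq_iff)
qed

text \<open>Nondegeneracy of the Hessian at the ground truth. The gradient equation, paired with the
  normalized displacement \<open>w\<close> and divided by its length, passes to the limit;
  symmetrizing gives a weighted sum of the squares of \<open>z $ i * l $ j + l $ i * z $ j\<close>
  equal to zero. With three indices this forces the unit vector \<open>l\<close> to vanish.\<close>

lemma no_accumulating_critical_points:
  fixes C :: "nat \<Rightarrow> real^'n^'n" and us u :: "nat \<Rightarrow> real^'n"
  assumes card: "CARD('n) \<ge> 3"
    and C: "C \<longlonglongrightarrow> C0" and us: "us \<longlonglongrightarrow> z" and u: "u \<longlonglongrightarrow> z"
    and sym: "\<And>i j. C0 $ i $ j = C0 $ j $ i" and nonneg: "\<And>i j. C0 $ i $ j \<ge> 0"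
    and pos: "\<And>i j. i \<noteq> j \<Longrightarrow> C0 $ i $ j > 0" and z: "\<And>i. z $ i \<noteq> 0"
    and grad: "\<And>k i. (\<Sum>j\<in>UNIV. C k $ i $ j * (u k $ i * u k $ j - us k $ i * us k $ j) * u k $ j) = 0"
    and ne: "\<And>k. u k \<noteq> us k"
  shows False
proof -
  define h where "h k = u k - us k" for k
  define w where "w k = h k /\<^sub>R norm (h k)" for k
  have h: "norm (h k) \<noteq> 0" for k using ne by (simp add: h_def)
  have nw: "norm (w k) = 1" for k using h[of k] by (simp add: w_def)
  have "bounded (range w)" unfolding bounded_iff using nw by auto
  then obtain l \<sigma> where \<sigma>: "strict_mono \<sigma>" "(w \<circ> \<sigma>) \<longlonglongrightarrow> l"
    using bounded_imp_convergent_subsequence by blast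
  have "norm l = 1"
    using tendsto_norm[OF \<sigma>(2)] nw by (simp add: LIMSEQ_const_iff o_def)
  have hw: "h k = norm (h k) *\<^sub>R w k" for k using h[of k] by (simp add: w_def)
  \<comment> \<open>The residual is exactly \<open>norm (h k)\<close> times the bracket, so this
    factor cancels without any error term.\<close>
  have key: "(\<Sum>i\<in>UNIV. \<Sum>j\<in>UNIV. C k $ i $ j *
    (u k $ i * w k $ j + w k $ i * u k $ j - norm (h k) * (w k $ i * w k $ j)) * u k $ j * w k $ i) = 0"
    (is "?S k = 0") for k
  proof -
    define t where "t = norm (h k)"
    have us_eq: "us k $ i = u k $ i - t * w k $ i" for i
      using hw[of k] by (metis h_def t_def diff_diff_eq2 add_diff_cancel_left' diff_add_cancel
          vector_minus_component vector_scaleR_component real_scaleR_def)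
    have "u k $ i * u k $ j - us k $ i * us k $ j
      = t * (u k $ i * w k $ j + w k $ i * u k $ j - t * (w k $ i * w k $ j))" for i j
      unfolding us_eq by (simp add: algebra_simps)
    then have "t * ?S k = (\<Sum>i\<in>UNIV. w k $ i *
      (\<Sum>j\<in>UNIV. C k $ i $ j * (u k $ i * u k $ j - us k $ i * us k $ j) * u k $ j))"
      unfolding sum_distrib_left by (intro sum.cong refl) (simp add: t_def)
    then have "t * ?S k = 0" by (simp only: grad mult_zero_right sum.neutral_const)
    then show ?thesis using h[of k] by (simp add: t_def)
  qed
  have "(\<lambda>k. norm (h k)) \<longlonglongrightarrow> norm (z - z)"
    unfolding h_def by (intro tendsto_intros u us)
  then have h0: "((\<lambda>k. norm (h k)) \<circ> \<sigma>) \<longlonglongrightarrow> 0"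
    using LIMSEQ_subseq_LIMSEQ[OF _ \<sigma>(1)] by auto
  have C': "(C \<circ> \<sigma>) \<longlonglongrightarrow> C0" and u': "(u \<circ> \<sigma>) \<longlonglongrightarrow> z"
    using LIMSEQ_subseq_LIMSEQ[OF _ \<sigma>(1)] C u by auto
  have "(?S \<circ> \<sigma>) \<longlonglongrightarrow> (\<Sum>i\<in>UNIV. \<Sum>j\<in>UNIV. C0 $ i $ j *
    (z $ i * l $ j + l $ i * z $ j - 0 * (l $ i * l $ j)) * z $ j * l $ i)"
    unfolding o_def
    by (intro tendsto_intros C'[unfolded o_def] u'[unfolded o_def] \<sigma>(2)[unfolded o_def]
        h0[unfolded o_def])
  then have lim: "(\<Sum>i\<in>UNIV. \<Sum>j\<in>UNIV. C0 $ i $ j * (z $ i * l $ j + l $ i * z $ j) * (z $ j * l $ i)) = 0"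
    using key by (simp add: o_def LIMSEQ_const_iff mult.assoc)
  define q where "q i j = C0 $ i $ j * (z $ i * l $ j + l $ i * z $ j)\<^sup>2" for i j
  have q0: "0 \<le> q i j" for i j using nonneg by (simp add: q_def)
  have "(\<Sum>i\<in>UNIV. \<Sum>j\<in>UNIV. q i j) =
    (\<Sum>i\<in>UNIV. \<Sum>j\<in>UNIV. C0 $ i $ j * (z $ i * l $ j + l $ i * z $ j) * (z $ j * l $ i)) +
    (\<Sum>j\<in>UNIV. \<Sum>i\<in>UNIV. C0 $ i $ j * (z $ i * l $ j + l $ i * z $ j) * (z $ i * l $ j))"
    unfolding sum.swap[of "\<lambda>j i. C0 $ i $ j * (z $ i * l $ j + l $ i * z $ j) * (z $ i * l $ j)"]
      sum.distrib[symmetric]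
    by (intro sum.cong refl) (simp add: q_def power2_eq_square algebra_simps)
  also have "(\<Sum>j\<in>UNIV. \<Sum>i\<in>UNIV. C0 $ i $ j * (z $ i * l $ j + l $ i * z $ j) * (z $ i * l $ j)) = 0"
    unfolding lim[symmetric] by (intro sum.cong refl) (simp add: sym add.commute mult.commute)
  finally have "(\<Sum>i\<in>UNIV. \<Sum>j\<in>UNIV. q i j) = 0" using lim by simp
  then have "q i j = 0" for i j
    using sum_nonneg_eq_0_iff[of UNIV "\<lambda>i. \<Sum>j\<in>UNIV. q i j"] sum_nonneg_eq_0_iff[of UNIV "q i"] q0
    by (simp add: sum_nonneg)
  then have pair: "z $ i * l $ j + l $ i * z $ j = 0" if "i \<noteq> j" for i j
    using pos[OF that] by (metis q_def mult_eq_0_iff power2_eq_square less_irrefl)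
  have "l $ i = 0" for i
  proof -
    \<comment> \<open>The ratios \<open>x\<close> sum to zero over every pair; three such equations
      on a triangle leave only zero.\<close>
    define x where "x a = l $ a / z $ a" for a
    have "x a + x b = 0" if "a \<noteq> b" for a b
      using pair[OF that] z[of a] z[of b] by (simp add: x_def field_simps)
    moreover obtain a b where "a \<noteq> i" "b \<noteq> i" "a \<noteq> b" using obtain_three[OF card] by metis
    ultimately have "x i + x a = 0" "x i + x b = 0" "x a + x b = 0" by auto
    then have "x i = 0" by linarith
    then show ?thesis using z[of i] by (simp add: x_def)
  qed
  then have "l = 0" by (simp add: vec_eq_iff)
  then show False using \<open>norm l = 1\<close> by simp
qed

text \<open>Pairing the gradient with \<open>u\<close> shows that \<open>x * (x - m)\<close>, with
  \<open>x\<close> and \<open>m\<close> the products of entries of \<open>u\<close> and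
  \<open>us\<close>, has weighted sum zero. Since \<open>m\<^sup>2 \<le> 1\<close>, also
  \<open>x\<^sup>2 \<le> 1 + 2 * (x * (x - m))\<close>, and the weights sum to 1.\<close>

lemma critical_energy_bound:
  fixes C :: "real^'n^'n"
  assumes C: "C \<in> S_C" and us: "us \<in> S_u"
    and grad: "\<And>i. (\<Sum>j\<in>UNIV. C $ i $ j * (u $ i * u $ j - us $ i * us $ j) * u $ j) = 0"
  shows "C $ i $ j * (u $ i * u $ j)\<^sup>2 \<le> 1"
proof -
  define e where "e a b = C $ a $ b * (u $ a * u $ b)\<^sup>2" for a b
  have e: "0 \<le> e a b" for a b using S_C_nonneg[OF C] by (simp add: e_def)
  have ptw: "e a b \<le> C $ a $ b + 2 * (u $ a * (C $ a $ b * (u $ a * u $ b - us $ a * us $ b) * u $ b))" for a b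
  proof -
    define x m where "x = u $ a * u $ b" and "m = us $ a * us $ b"
    have "\<bar>m\<bar> \<le> 1" using S_u_le_1[OF us, of a] S_u_le_1[OF us, of b]
      by (simp add: m_def abs_mult mult_le_one)
    then have "m\<^sup>2 \<le> 1" by (simp add: abs_square_le_1)
    moreover have "0 \<le> (x - m)\<^sup>2" by simp
    ultimately have "x\<^sup>2 \<le> 1 + 2 * (x * (x - m))" by (simp add: power2_eq_square algebra_simps)
    then have "C $ a $ b * x\<^sup>2 \<le> C $ a $ b * (1 + 2 * (x * (x - m)))"
      by (intro mult_left_mono S_C_nonneg C)
    then show ?thesis by (simp add: e_def x_def m_def algebra_simps)
  qed
  have "e i j \<le> (\<Sum>a\<in>UNIV. \<Sum>b\<in>UNIV. e a b)"
    using e by (intro member_le_double_sum) auto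
  also have "\<dots> \<le> (\<Sum>a\<in>UNIV. \<Sum>b\<in>UNIV. C $ a $ b +
      2 * (u $ a * (C $ a $ b * (u $ a * u $ b - us $ a * us $ b) * u $ b)))"
    by (intro sum_mono ptw)
  also have "\<dots> = 1"
    unfolding sum.distrib S_C_sum[OF C] sum_distrib_left[symmetric] grad by simp
  finally show ?thesis by (simp add: e_def)
qed

text \<open>The symmetric matrix \<open>F\<close> has zero row sums, so deleting row and column
  \<open>i\<close> leaves a block with sum \<open>F i i\<close>. This is nonnegative as soon as
  \<open>u $ i\<close> is at least \<open>us $ i\<close> in modulus.\<close>

lemma critical_residual_identity:
  fixes C :: "real^'n^'n"
  assumes C: "C \<in> S_C"
    and grad: "\<And>i. (\<Sum>j\<in>UNIV. C $ i $ j * (u $ i * u $ j - us $ i * us $ j) * u $ j) = 0"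
  shows "(\<Sum>j\<in>UNIV - {i}. \<Sum>l\<in>UNIV - {i}. C $ j $ l * (u $ j * u $ l) * (u $ j * u $ l - us $ j * us $ l))
    = C $ i $ i * (u $ i)\<^sup>2 * ((u $ i)\<^sup>2 - (us $ i)\<^sup>2)"
proof -
  define F where "F a b = C $ a $ b * (u $ a * u $ b) * (u $ a * u $ b - us $ a * us $ b)" for a b
  have row: "(\<Sum>b\<in>UNIV. F a b) = 0" for a
  proof -
    have "(\<Sum>b\<in>UNIV. F a b) = u $ a * (\<Sum>b\<in>UNIV. C $ a $ b * (u $ a * u $ b - us $ a * us $ b) * u $ b)"
      unfolding sum_distrib_left by (intro sum.cong refl) (simp add: F_def)
    then show ?thesis by (simp add: grad)
  qed
  have "F a b = F b a" for a b using S_C_sym[OF C, of a b] by (simp add: F_def mult_ac)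
  then have col: "(\<Sum>a\<in>UNIV - {i}. F a i) = (\<Sum>b\<in>UNIV - {i}. F i b)" by (intro sum.cong) auto
  have "(\<Sum>b\<in>UNIV - {i}. F i b) = - F i i" by (simp add: sum_remove_UNIV row)
  then have "(\<Sum>j\<in>UNIV - {i}. \<Sum>l\<in>UNIV - {i}. F j l) = F i i"
    using double_sum_split_cross[of F i] unfolding col row by simp
  then show ?thesis by (simp add: F_def power2_eq_square)
qed

lemma norm_vec_le_sum: "norm (x :: 'a::real_normed_vector^'n) \<le> (\<Sum>i\<in>UNIV. norm (x $ i))"
  unfolding norm_vec_def by (rule L2_set_le_sum) simp

lemma bounded_range_vecI:
  fixes x :: "'b \<Rightarrow> 'a::real_normed_vector^'n"
  assumes "\<And>i. \<exists>B. \<forall>k. norm (x k $ i) \<le> B"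
  shows "bounded (range x)"
proof -
  obtain B where "\<And>i k. norm (x k $ i) \<le> B i" using assms by metis
  then have "norm (x k) \<le> (\<Sum>i\<in>UNIV. B i)" for k
    by (intro order_trans[OF norm_vec_le_sum] sum_mono)
  then show ?thesis unfolding bounded_iff by blast
qed

text \<open>If the coordinate \<open>u\<^sub>i\<close> blows up, then \<open>u\<^sub>i u\<^sub>j\<close> converges to \<open>u\<^sup>*\<^sub>i u\<^sup>*\<^sub>j\<close> for
  all \<open>j \<noteq> i\<close>, so the other coordinates are too small to fit the remaining entries.\<close>
lemma no_escaping_critical_points:
  fixes C :: "nat \<Rightarrow> real^'n^'n" and us u :: "nat \<Rightarrow> real^'n"
  assumes card: "CARD('n) \<ge> 3"
    and C: "C \<longlonglongrightarrow> C0" and us: "us \<longlonglongrightarrow> z"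
    and CS: "\<And>k. C k \<in> S_C" and usS: "\<And>k. us k \<in> S_u"
    and nonneg: "\<And>i j. C0 $ i $ j \<ge> 0"
    and pos: "\<And>i j. i \<noteq> j \<Longrightarrow> C0 $ i $ j > 0" and z: "\<And>i. z $ i \<noteq> 0"
    and grad: "\<And>k i. (\<Sum>j\<in>UNIV. C k $ i $ j * (u k $ i * u k $ j - us k $ i * us k $ j) * u k $ j) = 0"
    and large: "\<And>k. \<bar>u k $ i\<bar> \<ge> real (Suc k)"
  shows False
proof -
  \<comment> \<open>Rescaling at infinity: for \<open>j \<noteq> i\<close> the coordinate
    \<open>u k $ j\<close> is \<epsilon> times \<open>y k $ j\<close>. The energy bound keeps
    \<open>y\<close> bounded because the limit weights off the diagonal are positive.\<close>
  define \<epsilon> where "\<epsilon> k = 1 / u k $ i" for k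
  define y :: "nat \<Rightarrow> real^'n" where "y k = (\<chi> j. if j = i then 0 else u k $ i * u k $ j)" for k
  have ui: "u k $ i \<noteq> 0" for k using large[of k] by auto
  have \<epsilon>0: "\<epsilon> \<longlonglongrightarrow> 0"
  proof (rule tendsto_rabs_zero_cancel, rule tendsto_sandwich[OF _ _ tendsto_const LIMSEQ_inverse_real_of_nat])
    show "\<forall>\<^sub>F k in sequentially. \<bar>\<epsilon> k\<bar> \<le> inverse (real (Suc k))"
      using large ui by (intro always_eventually allI) (simp add: \<epsilon>_def field_simps)
  qed simp
  have uy: "u k $ j = \<epsilon> k * y k $ j" if "j \<noteq> i" for j k
    using that ui[of k] by (simp add: y_def \<epsilon>_def)
  have "\<exists>B. \<forall>k. norm (y k $ j) \<le> B" for j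
  proof (cases "j = i")
    case False
    have Cij: "(\<lambda>k. C k $ i $ j) \<longlonglongrightarrow> C0 $ i $ j" by (intro tendsto_intros C)
    have p: "C0 $ i $ j > 0" using pos[of i j] False by simp
    have "(\<lambda>k. 1 + 1 / C k $ i $ j) \<longlonglongrightarrow> 1 + 1 / C0 $ i $ j"
      using p by (intro tendsto_intros Cij) auto
    then have "Bseq (\<lambda>k. 1 + 1 / C k $ i $ j)"
      by (intro convergent_imp_Bseq convergentI)
    moreover have "\<forall>\<^sub>F k in sequentially. norm (y k $ j) \<le> norm (1 + 1 / C k $ i $ j)"
      using order_tendstoD(1)[OF Cij p]
    proof eventually_elim
      case (elim k)
      have "C k $ i $ j * (y k $ j)\<^sup>2 \<le> 1"
        using critical_energy_bound[OF CS usS grad, of k i j] False by (simp add: y_def)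
      then have "(y k $ j)\<^sup>2 \<le> 1 / C k $ i $ j" using elim by (simp add: field_simps)
      moreover have "\<bar>y k $ j\<bar> \<le> 1 + (y k $ j)\<^sup>2"
        using zero_le_power2[of "\<bar>y k $ j\<bar> - 1"] unfolding power2_diff by simp
      ultimately show ?case by simp
    qed
    ultimately have "Bseq (\<lambda>k. y k $ j)" by (rule Bseq_eventually_mono[rotated])
    then show ?thesis unfolding Bseq_def by blast
  qed (auto simp: y_def)
  then obtain y0 \<sigma> where \<sigma>: "strict_mono \<sigma>" "(y \<circ> \<sigma>) \<longlonglongrightarrow> y0"
    using bounded_imp_convergent_subsequence[OF bounded_range_vecI] by blast
  note sub = LIMSEQ_subseq_LIMSEQ[OF _ \<sigma>(1), unfolded o_def]
  note lims = sub[OF C] sub[OF us] sub[OF \<epsilon>0] \<sigma>(2)[unfolded o_def]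
  have y0: "y0 $ j = z $ j * z $ i" if j: "j \<noteq> i" for j
  proof -
    \<comment> \<open>This is the gradient equation at \<open>j\<close> times \<epsilon>. In the
      limit only the summand \<open>l = i\<close> survives.\<close>
    have eq: "C k $ j $ i * (y k $ j - us k $ j * us k $ i) + (\<Sum>l\<in>UNIV - {i}.
      C k $ j $ l * ((\<epsilon> k)\<^sup>2 * (y k $ j * y k $ l) - us k $ j * us k $ l) * ((\<epsilon> k)\<^sup>2 * y k $ l)) = 0"
      (is "?E k = 0") for k
    proof -
      have "0 = \<epsilon> k * (\<Sum>l\<in>UNIV. C k $ j $ l * (u k $ j * u k $ l - us k $ j * us k $ l) * u k $ l)"
        by (simp only: grad mult_zero_right)
      also have "\<dots> = \<epsilon> k * (C k $ j $ i * (u k $ j * u k $ i - us k $ j * us k $ i) * u k $ i) +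
        (\<Sum>l\<in>UNIV - {i}. \<epsilon> k * (C k $ j $ l * (u k $ j * u k $ l - us k $ j * us k $ l) * u k $ l))"
        unfolding sum_distrib_left by (simp add: sum_remove_UNIV)
      also have "\<epsilon> k * (C k $ j $ i * (u k $ j * u k $ i - us k $ j * us k $ i) * u k $ i)
        = C k $ j $ i * (y k $ j - us k $ j * us k $ i)"
        using ui[of k] j by (simp add: \<epsilon>_def y_def mult.commute)
      also have "(\<Sum>l\<in>UNIV - {i}. \<epsilon> k * (C k $ j $ l * (u k $ j * u k $ l - us k $ j * us k $ l) * u k $ l))
        = (\<Sum>l\<in>UNIV - {i}. C k $ j $ l * ((\<epsilon> k)\<^sup>2 * (y k $ j * y k $ l) - us k $ j * us k $ l)
            * ((\<epsilon> k)\<^sup>2 * y k $ l))"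
        by (intro sum.cong refl) (simp add: uy j power2_eq_square algebra_simps)
      finally show ?thesis by simp
    qed
    have "(\<lambda>k. ?E (\<sigma> k)) \<longlonglongrightarrow> C0 $ j $ i * (y0 $ j - z $ j * z $ i) + (\<Sum>l\<in>UNIV - {i}.
      C0 $ j $ l * (0\<^sup>2 * (y0 $ j * y0 $ l) - z $ j * z $ l) * (0\<^sup>2 * y0 $ l))"
      by (intro tendsto_intros lims)
    then have "C0 $ j $ i * (y0 $ j - z $ j * z $ i) = 0"
      by (simp add: eq LIMSEQ_const_iff)
    then show ?thesis using pos[OF j] by simp
  qed
  \<comment> \<open>The residual identity divided by \<open>(\<epsilon> k)\<^sup>2\<close>; its sign
    holds because \<open>\<bar>u k $ i\<bar> \<ge> 1 \<ge> \<bar>us k $ i\<bar>\<close>. The limit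
    of the same expression turns out to be negative.\<close>
  have ge: "0 \<le> (\<Sum>j\<in>UNIV - {i}. \<Sum>l\<in>UNIV - {i}. C k $ j $ l * (y k $ j * y k $ l) *
      ((\<epsilon> k)\<^sup>2 * (y k $ j * y k $ l) - us k $ j * us k $ l))" (is "0 \<le> ?G k") for k
  proof -
    have "1 \<le> \<bar>u k $ i\<bar>" using large[of k] by simp
    then have "1\<^sup>2 \<le> \<bar>u k $ i\<bar>\<^sup>2" by (rule power_mono) simp
    moreover have "\<bar>us k $ i\<bar>\<^sup>2 \<le> 1\<^sup>2" by (intro power_mono S_u_le_1[OF usS]) simp
    ultimately have "0 \<le> C k $ i $ i * (u k $ i)\<^sup>2 * ((u k $ i)\<^sup>2 - (us k $ i)\<^sup>2)"
      using S_C_nonneg[OF CS] by simp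
    also have "\<dots> = (\<Sum>j\<in>UNIV - {i}. \<Sum>l\<in>UNIV - {i}. C k $ j $ l * (u k $ j * u k $ l) *
        (u k $ j * u k $ l - us k $ j * us k $ l))"
      by (rule critical_residual_identity[OF CS grad, symmetric])
    also have "\<dots> = (\<epsilon> k)\<^sup>2 * ?G k"
      unfolding sum_distrib_left
      by (intro sum.cong refl) (simp add: uy power2_eq_square algebra_simps)
    finally show ?thesis using ui[of k] by (simp add: zero_le_mult_iff \<epsilon>_def)
  qed
  have "(\<lambda>k. ?G (\<sigma> k)) \<longlonglongrightarrow> (\<Sum>j\<in>UNIV - {i}. \<Sum>l\<in>UNIV - {i}. C0 $ j $ l * (y0 $ j * y0 $ l) *
      (0\<^sup>2 * (y0 $ j * y0 $ l) - z $ j * z $ l))" (is "_ \<longlonglongrightarrow> ?L")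
    by (intro tendsto_intros lims)
  then have L: "0 \<le> ?L" by (rule LIMSEQ_le_const) (use ge in blast)
  define q where "q j l = C0 $ j $ l * (z $ i * z $ j * z $ l)\<^sup>2" for j l
  have "?L = (\<Sum>j\<in>UNIV - {i}. \<Sum>l\<in>UNIV - {i}. - q j l)"
    by (intro sum.cong refl) (simp add: y0 q_def power2_eq_square)
  then have q_le: "(\<Sum>j\<in>UNIV - {i}. \<Sum>l\<in>UNIV - {i}. q j l) \<le> 0"
    using L by (simp add: sum_negf)
  obtain j l where jl: "j \<noteq> i" "l \<noteq> i" "j \<noteq> l" using obtain_three[OF card] by metis
  have "q j l \<le> (\<Sum>j\<in>UNIV - {i}. \<Sum>l\<in>UNIV - {i}. q j l)"
    using jl nonneg by (intro member_le_double_sum) (auto simp: q_def)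
  moreover have "q j l > 0" using pos[OF jl(3)] z by (simp add: q_def)
  ultimately show False using q_le by simp
qed

section \<open>Compactness\<close>

lemma limit_instance:
  fixes C :: "nat \<Rightarrow> real^'n^'n" and us :: "nat \<Rightarrow> real^'n"
  assumes C: "C \<longlonglongrightarrow> C0" and us: "us \<longlonglongrightarrow> us0" and e: "e \<longlonglongrightarrow> 0"
    and CS: "\<And>k. C k \<in> S_C" and usS: "\<And>k. us k \<in> S_u"
    and far: "\<And>k C' us'. (C', us') \<in> degenerate_set \<Longrightarrow> d - e k \<le> inst_dist \<alpha> (C k) (us k) C' us'"
  shows "C0 \<in> S_C" "us0 \<in> S_u"
    and "\<And>C' us'. (C', us') \<in> degenerate_set \<Longrightarrow> d \<le> inst_dist \<alpha> C0 us0 C' us'"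
proof -
  have Cij: "(\<lambda>k. C k $ i $ j) \<longlonglongrightarrow> C0 $ i $ j" for i j by (intro tendsto_intros C)
  have "(\<lambda>k. C k $ i $ j) \<longlonglongrightarrow> C0 $ j $ i" for i j
    using Cij[of j i] S_C_sym[OF CS] by simp
  then have "C0 $ i $ j = C0 $ j $ i" for i j
    by (rule LIMSEQ_unique[OF Cij])
  moreover have "0 \<le> C0 $ i $ j" for i j
    by (rule LIMSEQ_le_const[OF Cij]) (use S_C_nonneg[OF CS] in blast)
  moreover have "(\<lambda>k. \<Sum>i\<in>UNIV. \<Sum>j\<in>UNIV. C k $ i $ j) \<longlonglongrightarrow> (\<Sum>i\<in>UNIV. \<Sum>j\<in>UNIV. C0 $ i $ j)"
    by (intro tendsto_intros C)
  then have "(\<Sum>i\<in>UNIV. \<Sum>j\<in>UNIV. C0 $ i $ j) = 1"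
    by (simp add: S_C_sum[OF CS] LIMSEQ_const_iff)
  ultimately show "C0 \<in> S_C" by (intro S_C_I)
  have "(\<lambda>k. l1_norm_vec (us k)) \<longlonglongrightarrow> l1_norm_vec us0"
    unfolding l1_norm_vec_def by (intro tendsto_intros us)
  then show "us0 \<in> S_u" using usS by (simp add: S_u_def LIMSEQ_const_iff)
  fix C' :: "real^'n^'n" and us' :: "real^'n"
  assume D: "(C', us') \<in> degenerate_set"
  have "(\<lambda>k. inst_dist \<alpha> (C k) (us k) C' us' + e k) \<longlonglongrightarrow> inst_dist \<alpha> C0 us0 C' us' + 0"
    unfolding inst_dist_def l1_norm_vec_def l1_norm_mat_def by (intro tendsto_intros us C e)
  then have "d \<le> inst_dist \<alpha> C0 us0 C' us' + 0"
    by (rule LIMSEQ_le_const) (use far[OF D] in \<open>auto simp: algebra_simps\<close>)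
  then show "d \<le> inst_dist \<alpha> C0 us0 C' us'" by simp
qed

lemma bounded_range_instances:
  fixes C :: "nat \<Rightarrow> real^'n^'n" and us :: "nat \<Rightarrow> real^'n"
  assumes "\<And>k. C k \<in> S_C" "\<And>k. us k \<in> S_u"
  shows "bounded (range (\<lambda>k. (C k, us k)))"
proof -
  have row: "norm (C k $ i) \<le> real CARD('n)" for k i
  proof -
    have "norm (C k $ i) \<le> (\<Sum>j\<in>UNIV. norm (C k $ i $ j))" by (rule norm_vec_le_sum)
    also have "\<dots> \<le> (\<Sum>j\<in>(UNIV :: 'n set). 1)"
      using assms(1) by (intro sum_mono) (auto simp: S_C_nonneg S_C_le_1)
    finally show ?thesis by simp
  qed
  have "bounded (range C)" by (rule bounded_range_vecI) (use row in blast)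
  moreover have "bounded (range us)"
    by (rule bounded_range_vecI) (use S_u_le_1[OF assms(2)] in \<open>auto\<close>)
  ultimately show ?thesis
    by (rule bounded_subset[OF bounded_Times]) auto
qed

text \<open>If no slack \<open>e\<close> worked, a sequence of counterexamples with slack tending to
  0 would exist. Its instances accumulate only at farthest instances, which are explicitly known,
  and the behaviour of critical points near these is excluded in every case.\<close>

lemma no_spurious_near_farthest:
  fixes \<alpha> :: real
  defines "n \<equiv> real CARD('n::finite)"
  assumes card: "CARD('n) \<ge> 5" and \<alpha>_def: "\<alpha> = (n\<^sup>2 - 5 * n + 4) / (n\<^sup>2 - 3 * n - 2)"
  shows "\<exists>e>0. \<forall>C\<in>S_C :: (real^'n^'n) set. \<forall>us\<in>S_u.
    (\<forall>(C', us')\<in>degenerate_set. 4 * \<alpha> / n - e \<le> inst_dist \<alpha> C us C' us') \<longrightarrow>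
    \<not> (\<exists>u. spurious_socp C us u)"
proof (rule ccontr)
  assume neg: "\<not> ?thesis"
  have card3: "CARD('n) \<ge> 3" using card by simp
  have n: "n \<ge> 5" using card by (simp add: n_def)
  define bad where "bad k C us u \<longleftrightarrow> C \<in> S_C \<and> us \<in> S_u \<and>
    (\<forall>(C', us')\<in>degenerate_set. 4 * \<alpha> / n - inverse (real (Suc k)) \<le> inst_dist \<alpha> C us C' us') \<and>
    spurious_socp C us u" for k and C :: "real^'n^'n" and us u
  have ex: "\<exists>C us u. bad k C us u" for k
  proof -
    have "inverse (real (Suc k)) > 0" by simp
    then show ?thesis using neg unfolding bad_def by blast
  qed
  have mono: "bad k C us u" if "bad l C us u" "k \<le> l" for k l C us u
  proof -
    have le: "inverse (real (Suc l)) \<le> inverse (real (Suc k))" using that(2) by (simp add: field_simps)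
    have far: "4 * \<alpha> / n - inverse (real (Suc l)) \<le> inst_dist \<alpha> C us C' us'"
      if "(C', us') \<in> degenerate_set" for C' us'
      using \<open>bad l C us u\<close> that by (auto simp: bad_def)
    have "4 * \<alpha> / n - inverse (real (Suc k)) \<le> inst_dist \<alpha> C us C' us'"
      if "(C', us') \<in> degenerate_set" for C' us'
      using le far[OF that] by linarith
    then show ?thesis using that(1) unfolding bad_def by blast
  qed
  have limit: "(\<forall>i j. C0 $ i $ j = (if i = j then 0 else 1 / (n * (n - 1)))) \<and> (\<forall>i. \<bar>us0 $ i\<bar> = 1 / n)"
    if bad: "\<And>k. bad k (C k) (us k) (u k)" and \<sigma>: "strict_mono \<sigma>"
      and lim: "(C \<circ> \<sigma>) \<longlonglongrightarrow> C0" "(us \<circ> \<sigma>) \<longlonglongrightarrow> us0" for C us u \<sigma> C0 us0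
  proof -
    have "((\<lambda>k. inverse (real (Suc k))) \<circ> \<sigma>) \<longlonglongrightarrow> 0"
      by (rule LIMSEQ_subseq_LIMSEQ[OF LIMSEQ_inverse_real_of_nat \<sigma>])
    moreover have "(C \<circ> \<sigma>) k \<in> S_C" "(us \<circ> \<sigma>) k \<in> S_u" for k
      using bad[of "\<sigma> k"] by (auto simp: bad_def)
    moreover have "4 * \<alpha> / n - ((\<lambda>k. inverse (real (Suc k))) \<circ> \<sigma>) k
        \<le> inst_dist \<alpha> ((C \<circ> \<sigma>) k) ((us \<circ> \<sigma>) k) C' us'" if "(C', us') \<in> degenerate_set" for k C' us'
      using bad[of "\<sigma> k"] that by (auto simp: bad_def)
    ultimately have "C0 \<in> S_C" "us0 \<in> S_u"
      "\<And>C' us'. (C', us') \<in> degenerate_set \<Longrightarrow> 4 * \<alpha> / n \<le> inst_dist \<alpha> C0 us0 C' us'"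
      using limit_instance[OF lim] by metis+
    then show ?thesis using farthest_instance[OF card \<alpha>_def[unfolded n_def]] unfolding n_def by blast
  qed
  have grad: "(\<Sum>j\<in>UNIV. C $ i $ j * (u $ i * u $ j - us $ i * us $ j) * u $ j) = 0"
    if "bad k C us u" for k C us u i
    using that critical_gradient by (auto simp: bad_def spurious_socp_def)
  have offdiag_pos: "1 / (n * (n - 1)) > 0" using n by simp
  \<comment> \<open>Unboundedness of coordinate \<open>i\<close> at every slack level would produce
    a sequence that escapes to infinity.\<close>
  have coord_bounded: "\<exists>K::nat. \<forall>C us u. bad K C us u \<longrightarrow> \<bar>u $ i\<bar> < real (Suc K)" for i
  proof (rule ccontr)
    assume "\<not> ?thesis"
    then have "\<forall>k. \<exists>C us u. bad k C us u \<and> \<bar>u $ i\<bar> \<ge> real (Suc k)" by (simp add: not_less)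
    then obtain C us u where bad: "\<And>k. bad k (C k) (us k) (u k)"
      and large: "\<And>k. \<bar>u k $ i\<bar> \<ge> real (Suc k)" by metis
    have CS: "C k \<in> S_C" and usS: "us k \<in> S_u" for k using bad[of k] by (auto simp: bad_def)
    have "bounded (range (\<lambda>k. (C k, us k)))" by (intro bounded_range_instances CS usS)
    then obtain l \<sigma> where \<sigma>: "strict_mono \<sigma>" and l: "((\<lambda>k. (C k, us k)) \<circ> \<sigma>) \<longlonglongrightarrow> l"
      using bounded_imp_convergent_subsequence by blast
    have lC: "(C \<circ> \<sigma>) \<longlonglongrightarrow> fst l" and lus: "(us \<circ> \<sigma>) \<longlonglongrightarrow> snd l"
      using tendsto_fst[OF l] tendsto_snd[OF l] by (simp_all add: o_def)
    have L: "fst l $ i $ j = (if i = j then 0 else 1 / (n * (n - 1)))" "\<bar>snd l $ i\<bar> = 1 / n" for i j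
      using limit[OF bad \<sigma> lC lus] by auto
    show False
    proof (rule no_escaping_critical_points[OF card3 lC lus, where u = "u \<circ> \<sigma>" and i = i])
      show "real (Suc k) \<le> \<bar>(u \<circ> \<sigma>) k $ i\<bar>" for k
        using large[of "\<sigma> k"] strict_mono_imp_increasing[OF \<sigma>, of k] by simp
      show "snd l $ j \<noteq> 0" for j using L(2)[of j] n by auto
      show "0 \<le> fst l $ j $ k" for j k using offdiag_pos by (simp add: L)
      show "0 < fst l $ j $ k" if "j \<noteq> k" for j k using offdiag_pos that by (simp add: L)
    qed (use grad[OF bad] CS usS in auto)
  qed
  then obtain K where K: "\<And>i C us u. bad (K i) C us u \<Longrightarrow> \<bar>u $ i\<bar> < real (Suc (K i))" by metis
  \<comment> \<open>\<open>B\<close> dominates the thresholds of all coordinates, so counterexamples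
    of index at least \<open>B\<close> are bounded in every coordinate.\<close>
  define B where "B = (\<Sum>i\<in>(UNIV :: 'n set). K i)"
  have KB: "K i \<le> B" for i unfolding B_def by (intro member_le_sum) auto
  have "\<forall>k. \<exists>C us u. bad (B + k) C us u" using ex by blast
  then obtain C us u where bad': "\<And>k. bad (B + k) (C k) (us k) (u k)" by metis
  have bad: "bad k (C k) (us k) (u k)" for k by (rule mono[OF bad']) simp
  have CS: "C k \<in> S_C" and usS: "us k \<in> S_u" for k using bad[of k] by (auto simp: bad_def)
  have "\<bar>u k $ i\<bar> \<le> real (Suc (K i))" for k i
    using K[OF mono[OF bad'], of i k] KB[of i] by simp
  then have "bounded (range u)" by (intro bounded_range_vecI) (auto intro: exI)
  moreover have "bounded (range (\<lambda>k. (C k, us k)))" by (intro bounded_range_instances CS usS)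
  ultimately have "bounded (range (\<lambda>k. (C k, us k)) \<times> range u)" by (rule bounded_Times[rotated])
  then have "bounded (range (\<lambda>k. ((C k, us k), u k)))"
    by (rule bounded_subset) auto
  then obtain l \<sigma> where \<sigma>: "strict_mono \<sigma>" and l: "((\<lambda>k. ((C k, us k), u k)) \<circ> \<sigma>) \<longlonglongrightarrow> l"
    using bounded_imp_convergent_subsequence by blast
  define C0 us0 u0 where "C0 = fst (fst l)" and "us0 = snd (fst l)" and "u0 = snd l"
  have lC: "(C \<circ> \<sigma>) \<longlonglongrightarrow> C0" and lus: "(us \<circ> \<sigma>) \<longlonglongrightarrow> us0" and lu: "(u \<circ> \<sigma>) \<longlonglongrightarrow> u0"
    using tendsto_fst[OF tendsto_fst[OF l]] tendsto_snd[OF tendsto_fst[OF l]] tendsto_snd[OF l]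
    by (simp_all add: o_def C0_def us0_def u0_def)
  note lims = lC[unfolded o_def] lus[unfolded o_def] lu[unfolded o_def]
  have C0: "C0 $ i $ j = (if i = j then 0 else 1 / (n * (n - 1)))" and us0: "\<bar>us0 $ i\<bar> = 1 / n" for i j
    using limit[OF bad \<sigma> lC lus] by auto
  have "u0 = us0 \<or> u0 = - us0"
  proof (rule critical_points_uniform_instance[OF card3 C0 offdiag_pos us0])
    show "1 / n > 0" using n by simp
    have "(\<lambda>k. \<Sum>j\<in>UNIV. C (\<sigma> k) $ i $ j * (u (\<sigma> k) $ i * u (\<sigma> k) $ j - us (\<sigma> k) $ i * us (\<sigma> k) $ j)
      * u (\<sigma> k) $ j) \<longlonglongrightarrow> (\<Sum>j\<in>UNIV. C0 $ i $ j * (u0 $ i * u0 $ j - us0 $ i * us0 $ j) * u0 $ j)" for i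
      by (intro tendsto_intros lims)
    then show "(\<Sum>j\<in>UNIV. C0 $ i $ j * (u0 $ i * u0 $ j - us0 $ i * us0 $ j) * u0 $ j) = 0" for i
      by (simp add: grad[OF bad] LIMSEQ_const_iff)
    define Q where "Q C us u = (\<Sum>i\<in>UNIV. \<Sum>j\<in>UNIV. C $ i $ j * ((u $ i * us $ j + us $ i * u $ j)\<^sup>2
      + 2 * ((u $ i * u $ j - us $ i * us $ j) * (us $ i * us $ j))))" for C :: "real^'n^'n" and us u
    have Q: "0 \<le> Q (C k) (us k) (u k)" for k
      unfolding Q_def
      by (rule second_order_critical_mc(2)) (use bad[of k] in \<open>simp add: bad_def spurious_socp_def\<close>)
    have "(\<lambda>k. Q (C (\<sigma> k)) (us (\<sigma> k)) (u (\<sigma> k))) \<longlonglongrightarrow> Q C0 us0 u0"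
      unfolding Q_def by (intro tendsto_intros lims)
    then have "0 \<le> Q C0 us0 u0" by (rule LIMSEQ_le_const) (use Q in blast)
    then show "0 \<le> (\<Sum>i\<in>UNIV. \<Sum>j\<in>UNIV. C0 $ i $ j * ((u0 $ i * us0 $ j + us0 $ i * u0 $ j)\<^sup>2
      + 2 * ((u0 $ i * u0 $ j - us0 $ i * us0 $ j) * (us0 $ i * us0 $ j))))"
      by (simp add: Q_def)
  qed
  \<comment> \<open>The sign \<open>s\<close> treats both limits at once: replacing
    \<open>us\<close> by \<open>s *\<^sub>R us\<close> leaves all products of entries
    unchanged.\<close>
  then obtain s :: real where s: "s * s = 1" "u0 = s *\<^sub>R us0"
    using that[of 1] that[of "-1"] by auto
  have ne: "u k \<noteq> s *\<^sub>R us k" for k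
  proof
    assume "u k = s *\<^sub>R us k"
    then have "u k $ i * u k $ j = (s * s) * (us k $ i * us k $ j)" for i j by simp
    then have "outer (u k) = outer (us k)" by (simp add: s outer_def)
    then show False using bad[of k] by (simp add: bad_def spurious_socp_def)
  qed
  show False
  proof (rule no_accumulating_critical_points[OF card3 lC _ lu, where us = "\<lambda>k. s *\<^sub>R us (\<sigma> k)"])
    show "(\<lambda>k. s *\<^sub>R us (\<sigma> k)) \<longlonglongrightarrow> u0" unfolding s(2) by (intro tendsto_intros lims)
    show "u0 $ i \<noteq> 0" for i using us0[of i] n s by auto
    show "0 \<le> C0 $ j $ k" for j k using offdiag_pos by (simp add: C0)
    show "0 < C0 $ j $ k" if "j \<noteq> k" for j k using offdiag_pos that by (simp add: C0)
    show "(u \<circ> \<sigma>) k \<noteq> s *\<^sub>R us (\<sigma> k)" for k using ne by simp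
    have ss: "(s * x) * (s * y) = x * y" for x y by (metis s(1) mult_1 mult.assoc mult.left_commute)
    show "(\<Sum>j\<in>UNIV. (C \<circ> \<sigma>) k $ i $ j * ((u \<circ> \<sigma>) k $ i * (u \<circ> \<sigma>) k $ j -
        (s *\<^sub>R us (\<sigma> k)) $ i * (s *\<^sub>R us (\<sigma> k)) $ j) * (u \<circ> \<sigma>) k $ j) = 0" for k i
      using grad[OF bad] by (simp add: ss)
  qed (auto simp: C0)
qed

section \<open>From the complexity metric to distances\<close>

lemma complexity_metric_leD:
  fixes C :: "real^'n^'n"
  assumes le: "complexity_metric \<alpha> C us \<le> ereal x" and x: "x > 0" and \<alpha>: "0 \<le> \<alpha>" "\<alpha> \<le> 1"
    and D: "(C', us') \<in> degenerate_set"
  shows "1 / x \<le> inst_dist \<alpha> C us C' us'"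
proof -
  define I where "I = (INF (C', us')\<in>degenerate_set. ereal (inst_dist \<alpha> C us C' us'))"
  have nonneg: "0 \<le> inst_dist \<alpha> C us C' us'" for C' us'
    using \<alpha> by (auto simp: inst_dist_def l1_norm_mat_def l1_norm_vec_def intro!: add_nonneg_nonneg mult_nonneg_nonneg sum_nonneg)
  have "0 \<le> I" unfolding I_def using nonneg by (intro INF_greatest) auto
  moreover have "I \<le> ereal (inst_dist \<alpha> C us C' us')"
    unfolding I_def by (rule INF_lower2[OF D]) simp
  ultimately have "inverse (ereal (inst_dist \<alpha> C us C' us')) \<le> inverse I"
    by (rule ereal_inverse_antimono)
  also have "\<dots> \<le> ereal x" using le unfolding complexity_metric_def I_def inst_dist_def .
  \<comment> \<open>A distance of 0 would have inverse \<infinity>, contradicting the finite bound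
    \<open>x\<close>.\<close>
  finally show ?thesis
    using nonneg[of C' us'] x by (cases "inst_dist \<alpha> C us C' us' = 0") (auto simp: field_simps)
qed

theorem theorem4p1:
  fixes n :: nat and \<alpha> :: real
  assumes "n = CARD('n::finite)"
    and "n \<ge> 5"
    and "\<alpha> = ((real n)\<^sup>2 - 5 * real n + 4) / ((real n)\<^sup>2 - 3 * real n - 2)"
  shows "\<exists>\<delta>::real. \<delta> > 1/4 \<and>
    (\<forall>C \<in> (S_C :: (real^'n^'n) set). \<forall>us \<in> (S_u :: (real^'n) set).
      complexity_metric \<alpha> C us \<le> ereal (\<delta> * real n / \<alpha>) \<longrightarrow>
        \<not> (\<exists>u. spurious_socp C us u))"
proof -
  have n: "real n \<ge> 5" using assms(2) by simp
  note \<alpha> = alpha_bounds[OF n assms(3)]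
  obtain e where e: "e > 0" and robust: "\<forall>C\<in>S_C :: (real^'n^'n) set. \<forall>us\<in>S_u.
    (\<forall>(C', us')\<in>degenerate_set. 4 * \<alpha> / real n - e \<le> inst_dist \<alpha> C us C' us') \<longrightarrow>
    \<not> (\<exists>u. spurious_socp C us u)"
    using no_spurious_near_farthest[where ?'n = 'n and \<alpha> = \<alpha>] assms by auto
  \<comment> \<open>\<open>1 / \<delta> = 4 - t\<close> turns the metric bound into a distance of at
    least \<open>4 * \<alpha> / n\<close> minus \<open>t * \<alpha> / n\<close>. The minimum keeps
    this loss at most \<open>e\<close> and \<open>4 - t\<close> positive.\<close>
  define t where "t = min 1 (e * real n / \<alpha>)"
  have t: "0 < t" "t \<le> 1" "t * \<alpha> / real n \<le> e"
    using e n \<alpha>(1) by (auto simp: t_def min_def field_simps)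
  define \<delta> where "\<delta> = 1 / (4 - t)"
  have \<delta>: "\<delta> > 1/4" using t by (simp add: \<delta>_def field_simps)
  have "1 / (\<delta> * real n / \<alpha>) = 4 * \<alpha> / real n - t * \<alpha> / real n"
    using t n \<alpha>(1) by (simp add: \<delta>_def field_simps)
  then have inv: "4 * \<alpha> / real n - e \<le> 1 / (\<delta> * real n / \<alpha>)" using t by simp
  have pos: "\<delta> * real n / \<alpha> > 0" using \<delta> n \<alpha>(1) by simp
  have "\<not> (\<exists>u. spurious_socp C us u)"
    if "C \<in> S_C" "us \<in> S_u" "complexity_metric \<alpha> C us \<le> ereal (\<delta> * real n / \<alpha>)"
    for C :: "real^'n^'n" and us
  proof -
    have "4 * \<alpha> / real n - e \<le> inst_dist \<alpha> C us C' us'" if "(C', us') \<in> degenerate_set" for C' us'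
      using inv complexity_metric_leD[OF \<open>complexity_metric \<alpha> C us \<le> _\<close> pos _ _ that] \<alpha> by linarith
    then show ?thesis using robust that(1,2) by blast
  qed
  then show ?thesis using \<delta> by blast
qed

end
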